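(* Let $\{x(t)\}_{t\ge 1}$ be the iterates of the stochastic mirror descent algorithm $$x(t+1)=\operatorname*{arg\,min}_{x\in\mathbb{X}}\Big\{\langle \tilde g(t),x-x(t)\rangle+\frac{1}{\alpha(t)}\mathbb{D}_R(x,x(t))\Big\},\qquad t\ge 1,$$ for the problem $\min_{x\in\mathbb{X}}f(x)$, under Assumptions A1, A2, A3 of the context, and let $z(t)=\big(\sum_{k=1}^t\alpha(k)\big)^{-1}\sum_{j=1}^t\alpha(j)x(j)$. Let $\epsilon>0$, let $0<p<1$ be a confidence level, $p_1=1-p$, and $\mathcal{R}=\sup_{x,y\in\mathbb{X}}\mathbb{D}_R(x,y)$. Define $t_0,t_1,t_2$ such that: (i) for all $t\ge t_0$, $\ \sum_{k=1}^t\alpha(k)\ge\frac{3}{\epsilon}\exp\Big(\sum_{k=1}^\infty\frac{2\alpha(k)B(k)}{\sigma_R}\Big)\Big(\mathcal{R}+\sum_{k=1}^t\alpha(k)B(k)\Big)$; (ii) for all $t\ge t_1$, $\ \sum_{k=1}^t\alpha(k)\ge\frac{3\nu^2}{\sigma_R\,\epsilon\,p_1}\exp\Big(\sum_{k=1}^\infty\frac{2\alpha(k)B(k)}{\sigma_R}\Big)\sum_{k=1}^t\alpha(k)^2$; (iii) for all $t\ge t_2$, $\ \Big(\sum_{k=1}^t\alpha(k)\Big)^2\ge\frac{9D^2\kappa_1}{\epsilon^2}\exp\Big(\sum_{k=1}^\infty\frac{2\alpha(k)B(k)}{\sigma_R}\Big)\sum_{k=1}^t\alpha(k)^2\big(\nu^2+G^2+B(k)^2\big)$.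 Then for all $t\ge\max\{t_0,t_1,t_2\}$ one has $\mathbb{P}\big(f(z(t))-f^\ast<\epsilon\big)\ge p$. Moreover, $\max\{t_0,t_1,t_2\}<\infty$ due to Assumptions A2 and A3.
   Context: Setting. $\|\cdot\|$ is a norm on $\mathbb{R}^n$ and $\|x\|_\ast=\sup\{\langle x,y\rangle:\|y\|\le 1\}$ its dual norm. $\mathbb{X}\subseteq\mathbb{R}^n$ is convex and compact with diameter $D$. $f:\mathbb{R}^n\to\mathbb{R}$ is convex and continuous, $f^\ast=\min_{x\in\mathbb{X}}f(x)$. $G>0$ is a constant with $\|g\|_\ast\le G$ for all $g\in\partial f(x)$ and all $x\in\mathbb{X}$. Bregman divergence. $R$ is $\sigma_R$-strongly convex and differentiable on an open set containing $\mathbb{X}$, and $\mathbb{D}_R(x,y)=R(x)-R(y)-\langle\nabla R(y),x-y\rangle$ for $x,y\in\mathbb{X}$; in particular $\mathbb{D}_R(x,y)\ge\frac{\sigma_R}{2}\|x-y\|^2$. Algorithm. $\alpha(t)>0$ are the step-sizes, and $\tilde g(t)$ is a noisy subgradient of $f$ at $x(t)$. $\mathcal{F}_t=\sigma(x(1),\dots,x(t))$. Assumption A1. $\mathbb{E}[\tilde g(t)\mid\mathcal{F}_t]=g(t)+b(t)$, where $g(t)$ is a subgradient of $f$ at $x(t)$ and $b(t)$ (the bias) is $\mathcal{F}_t$-measurable; and $\mathbb{E}[\|\tilde g(t)\|_\ast^2\mid\mathcal{F}_t]\le\nu^2$ a.s. Assumption A2. $\sum_{t\ge1}\alpha(t)=\infty$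 and $\sum_{t\ge1}\alpha(t)^2<\infty$. Assumption A3. With $B(t)=\|b(t)\|_\ast$, $\sum_{t\ge1}\alpha(t)B(t)<\infty$. Constant $\kappa_1$. $\kappa_1>0$ is a norm-equivalence constant such that $\|u+v+w\|_\ast^2\le\kappa_1(\|u\|_\ast^2+\|v\|_\ast^2+\|w\|_\ast^2)$ for all $u,v,w\in\mathbb{R}^n$; it is used to bound the noise $\zeta(t)=\tilde g(t)-g(t)-b(t)$ by $\mathbb{E}[\|\zeta(t)\|_\ast^2]\le\kappa_1(\nu^2+G^2+B(t)^2)$. *)

theory Defs
  imports "HOL-Probability.Probability"
begin

(* The norm of the problem is an arbitrary one, in general not the Euclidean
   norm that the type class attaches to the vector type. *)
definition is_norm :: "('a::real_vector \<Rightarrow> real) \<Rightarrow> bool" where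
  "is_norm nrm \<longleftrightarrow>
     (\<forall>x. 0 \<le> nrm x) \<and> (\<forall>x. nrm x = 0 \<longleftrightarrow> x = 0) \<and>
     (\<forall>c x. nrm (c *\<^sub>R x) = \<bar>c\<bar> * nrm x) \<and>
     (\<forall>x y. nrm (x + y) \<le> nrm x + nrm y)"

definition dual_norm :: "('a::real_inner \<Rightarrow> real) \<Rightarrow> 'a \<Rightarrow> real" where
  "dual_norm nrm x = (SUP y\<in>{y. nrm y \<le> 1}. x \<bullet> y)"

definition norm_diameter :: "('a::real_vector \<Rightarrow> real) \<Rightarrow> 'a set \<Rightarrow> real" where
  "norm_diameter nrm X = (SUP (x, y)\<in>X \<times> X. nrm (x - y))"

definition subdifferential :: "('a::real_inner \<Rightarrow> real) \<Rightarrow> 'a \<Rightarrow> 'a set" where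
  "subdifferential f x = {g. \<forall>y. f x + g \<bullet> (y - x) \<le> f y}"

definition strongly_convex_on ::
    "('a::real_vector \<Rightarrow> real) \<Rightarrow> 'a set \<Rightarrow> real \<Rightarrow> ('a \<Rightarrow> real) \<Rightarrow> bool" where
  "strongly_convex_on nrm U \<sigma> R \<longleftrightarrow>
     convex U \<and> 0 < \<sigma> \<and>
     (\<forall>x\<in>U. \<forall>y\<in>U. \<forall>u\<in>{0..1}.
        R (u *\<^sub>R x + (1 - u) *\<^sub>R y)
          \<le> u * R x + (1 - u) * R y - \<sigma> / 2 * u * (1 - u) * (nrm (x - y))\<^sup>2)"

definition gradient :: "('a::real_inner \<Rightarrow> real) \<Rightarrow> 'a \<Rightarrow> 'a" where
  "gradient R x = (THE D. GDERIV R x :> D)"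

definition bregman :: "('a::real_inner \<Rightarrow> real) \<Rightarrow> 'a \<Rightarrow> 'a \<Rightarrow> real" where
  "bregman R x y = R x - R y - gradient R y \<bullet> (x - y)"

(* The sigma-algebra generated by x(1), ..., x(t). *)
definition history :: "'w measure \<Rightarrow> (nat \<Rightarrow> 'w \<Rightarrow> 'a::topological_space) \<Rightarrow> nat \<Rightarrow> 'w measure" where
  "history M x t =
     sigma (space M) (\<Union>i\<in>{1..t}. {x i -` A \<inter> space M | A. A \<in> sets borel})"

(* The library's conditional expectation is real-valued; for vectors it is
   taken coordinate by coordinate. *)
definition vector_cond_exp ::
    "'w measure \<Rightarrow> 'w measure \<Rightarrow> ('w \<Rightarrow> 'a::euclidean_space) \<Rightarrow> 'w \<Rightarrow> 'a" where
  "vector_cond_exp M F h \<omega> =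
     (\<Sum>i\<in>Basis. real_cond_exp M F (\<lambda>\<omega>'. h \<omega>' \<bullet> i) \<omega> *\<^sub>R i)"

definition weighted_average :: "(nat \<Rightarrow> real) \<Rightarrow> (nat \<Rightarrow> 'a::real_vector) \<Rightarrow> nat \<Rightarrow> 'a" where
  "weighted_average \<alpha> x t = inverse (\<Sum>k=1..t. \<alpha> k) *\<^sub>R (\<Sum>j=1..t. \<alpha> j *\<^sub>R x j)"

(* Sequences are indexed from 1, so the series over k \<ge> 1 is summed at Suc k. *)
definition bias_factor :: "real \<Rightarrow> (nat \<Rightarrow> real) \<Rightarrow> (nat \<Rightarrow> real) \<Rightarrow> real" where
  "bias_factor \<sigma> \<alpha> B = exp (\<Sum>k. 2 * \<alpha> (Suc k) * B (Suc k) / \<sigma>)"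

(* The three lower bounds on the accumulated step-size that define
   t0, t1 and t2; B is the bias magnitude along one sample path. *)
definition condition_i ::
    "real \<Rightarrow> real \<Rightarrow> real \<Rightarrow> (nat \<Rightarrow> real) \<Rightarrow> (nat \<Rightarrow> real) \<Rightarrow> nat \<Rightarrow> bool" where
  "condition_i \<epsilon> \<sigma> Rsup \<alpha> B t \<longleftrightarrow>
     (\<Sum>k=1..t. \<alpha> k) \<ge> 3 / \<epsilon> * bias_factor \<sigma> \<alpha> B * (Rsup + (\<Sum>k=1..t. \<alpha> k * B k))"

definition condition_ii ::
    "real \<Rightarrow> real \<Rightarrow> real \<Rightarrow> real \<Rightarrow> (nat \<Rightarrow> real) \<Rightarrow> (nat \<Rightarrow> real) \<Rightarrow> nat \<Rightarrow> bool" where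
  "condition_ii \<epsilon> \<sigma> \<nu> p1 \<alpha> B t \<longleftrightarrow>
     (\<Sum>k=1..t. \<alpha> k)
       \<ge> 3 * \<nu>\<^sup>2 / (\<sigma> * \<epsilon> * p1) * bias_factor \<sigma> \<alpha> B * (\<Sum>k=1..t. (\<alpha> k)\<^sup>2)"

definition condition_iii ::
    "real \<Rightarrow> real \<Rightarrow> real \<Rightarrow> real \<Rightarrow> real \<Rightarrow> real \<Rightarrow> (nat \<Rightarrow> real) \<Rightarrow> (nat \<Rightarrow> real) \<Rightarrow> nat \<Rightarrow> bool" where
  "condition_iii \<epsilon> \<sigma> \<nu> G D \<kappa>\<^sub>1 \<alpha> B t \<longleftrightarrow>
     (\<Sum>k=1..t. \<alpha> k)\<^sup>2
       \<ge> 9 * D\<^sup>2 * \<kappa>\<^sub>1 / \<epsilon>\<^sup>2 * bias_factor \<sigma> \<alpha> B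
           * (\<Sum>k=1..t. (\<alpha> k)\<^sup>2 * (\<nu>\<^sup>2 + G\<^sup>2 + (B k)\<^sup>2))"

end

theory Submission
  imports Defs
begin

text \<open>The proof compares the iterates with a minimizer \<open>y\<close> of \<open>f\<close> on \<open>X\<close> through the
  potential \<open>Y k = bregman R y (x k)\<close>, which takes values in \<open>[0, Rsup]\<close>. Optimality of the
  mirror step gives, sample point by sample point, the descent inequality
  \<open>\<alpha> k * h k \<le> Y k - Y (k + 1) + (\<alpha> k)\<^sup>2 / (2 * \<sigma>) * s k\<close>, where \<open>h k\<close> is the inner product of the noisy
  subgradient with \<open>x k - y\<close> and \<open>s k\<close> is its squared dual norm (\<open>mirror_step_descent\<close>). The
  optimality gap at \<open>x k\<close> is at most the conditional expectation of \<open>h k\<close> given the history up to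
  \<open>k\<close>, up to a bias term.

  The noise is not a martingale difference for the filtration generated by the iterates: a noisy
  subgradient need not be a function of the iterates, because distinct subgradients can lead to
  the same \<open>x (k + 1)\<close>, so the noise at different times can be correlated. However, the descent
  inequality is linear in \<open>h k\<close> and \<open>s k\<close>, and the remaining terms are determined by
  \<open>x 1, \<dots>, x (k + 1)\<close>. Taking conditional expectations given the history up to \<open>k + 1\<close>
  therefore replaces \<open>h k\<close> by a variable that is known at time \<open>k + 1\<close> and has the same
  conditional mean given the history up to \<open>k\<close>. The differences of these two conditional
  expectations are orthogonal, and their second moments are bounded by that of \<open>h k\<close>. This
  gives a sum \<open>Q \<ge> 0\<close> of quadratic terms and a sum \<open>N\<close> of orthogonal noise terms with
  \<open>\<Sum> \<alpha> k * E[h k | history k] \<le> Rsup + Q + N\<close> (\<open>conditioned_descent\<close>).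

  Put \<open>c = \<epsilon> * \<Sum> \<alpha> k\<close>. Condition (i) makes \<open>Rsup\<close> together with the bias at most \<open>c / 3\<close>
  (\<open>bias_absorption\<close>), so that a gap of at least \<open>\<epsilon>\<close> forces \<open>Q + N \<ge> 2 * c / 3\<close>. Condition (ii)
  gives \<open>E Q \<le> c * p1 / 6\<close>. By strong convexity, every pair of points of \<open>X\<close> is at squared distance
  at most \<open>2 * Rsup / \<sigma>\<close>, so conditions (i) and (ii) together also bound the noise:
  \<open>E N\<^sup>2 \<le> (2 * Rsup / \<sigma>) * \<nu>\<^sup>2 * \<Sum> (\<alpha> k)\<^sup>2 \<le> 2 * c\<^sup>2 * p1 / 9\<close>. Treating \<open>Q\<close> and \<open>N\<close> by one application of
  Markov's inequality, to \<open>Q / c + (N / c)\<^sup>2\<close>, keeps the failure probability below \<open>p1\<close>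
  (\<open>combined_tail_bound\<close>); Markov's inequality for \<open>Q\<close> and Chebyshev's for \<open>N\<close>
  would together exceed it.

  The thresholds exist because the right-hand sides of the three conditions stay bounded as \<open>t\<close>
  grows, with bounds that depend on the bias only through the sum of the series of
  \<open>\<alpha> k * B k\<close> (\<open>thresholds_exist\<close>).\<close>

section \<open>Norms on a Euclidean space\<close>

lemma is_normD:
  assumes "is_norm nrm"
  shows "0 \<le> nrm x" "nrm 0 = 0" "x \<noteq> 0 \<Longrightarrow> 0 < nrm x" "nrm (c *\<^sub>R x) = \<bar>c\<bar> * nrm x"
    "nrm (x + y) \<le> nrm x + nrm y"
  using assms unfolding is_norm_def by (auto simp: less_le)

lemma is_norm_convex:
  fixes nrm :: "'a::euclidean_space \<Rightarrow> real"
  assumes "is_norm nrm"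
  shows "convex_on UNIV nrm"
proof (rule convex_onI)
  fix t :: real and x y :: 'a
  assume "0 < t" "t < 1"
  have "nrm ((1 - t) *\<^sub>R x + t *\<^sub>R y) \<le> nrm ((1 - t) *\<^sub>R x) + nrm (t *\<^sub>R y)"
    by (rule is_normD(5)[OF assms])
  also have "\<dots> = (1 - t) * nrm x + t * nrm y"
    using \<open>0 < t\<close> \<open>t < 1\<close> by (simp add: is_normD(4)[OF assms])
  finally show "nrm ((1 - t) *\<^sub>R x + t *\<^sub>R y) \<le> (1 - t) * nrm x + t * nrm y" .
qed simp

lemma is_norm_continuous:
  fixes nrm :: "'a::euclidean_space \<Rightarrow> real"
  assumes "is_norm nrm"
  shows "continuous_on UNIV nrm"
  by (rule convex_on_continuous[OF open_UNIV is_norm_convex[OF assms]])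

lemma is_norm_minus:
  assumes "is_norm nrm"
  shows "nrm (- x) = nrm x"
proof -
  have "nrm ((-1) *\<^sub>R x) = \<bar>-1\<bar> * nrm x"
    by (rule is_normD(4)[OF assms])
  then show ?thesis by simp
qed

text \<open>Half of the equivalence of norms in finite dimension; it makes the supremum in the dual norm
  finite.\<close>

lemma is_norm_lower_bound:
  fixes nrm :: "'a::euclidean_space \<Rightarrow> real"
  assumes n: "is_norm nrm"
  shows "\<exists>c>0. \<forall>x. c * norm x \<le> nrm x"
proof -
  have "compact (sphere (0::'a) 1)" "sphere (0::'a) 1 \<noteq> {}"
    by auto
  moreover have "continuous_on (sphere 0 1) nrm"
    using is_norm_continuous[OF n] continuous_on_subset by blast
  ultimately obtain e where e: "e \<in> sphere 0 1" "\<forall>y\<in>sphere 0 1. nrm e \<le> nrm y"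
    by (metis continuous_attains_inf)
  have "e \<noteq> 0" using e(1) by auto
  then have "0 < nrm e"
    by (rule is_normD(3)[OF n])
  moreover have "nrm e * norm x \<le> nrm x" for x
  proof (cases "x = 0")
    case True
    then show ?thesis by (simp add: is_normD(2)[OF n])
  next
    case False
    then have "nrm e \<le> nrm (inverse (norm x) *\<^sub>R x)"
      by (intro e(2)[rule_format]) simp
    also have "\<dots> = inverse (norm x) * nrm x"
      by (simp add: is_normD(4)[OF n])
    finally show ?thesis using False by (simp add: field_simps)
  qed
  ultimately show ?thesis by blast
qed

lemma dual_norm_bdd_above:
  fixes nrm :: "'a::euclidean_space \<Rightarrow> real"
  assumes n: "is_norm nrm"
  shows "bdd_above ((\<lambda>y. x \<bullet> y) ` {y. nrm y \<le> 1})"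
proof -
  obtain c where c: "0 < c" "\<And>x. c * norm x \<le> nrm x"
    using is_norm_lower_bound[OF n] by blast
  show ?thesis
  proof (rule bdd_aboveI2)
    fix y assume "y \<in> {y. nrm y \<le> 1}"
    then have "norm y \<le> 1 / c" using c(1) c(2)[of y] by (simp add: field_simps)
    moreover have "x \<bullet> y \<le> norm x * norm y" by (rule norm_cauchy_schwarz)
    ultimately show "x \<bullet> y \<le> norm x * (1 / c)"
      by (meson mult_left_mono norm_ge_zero order_trans)
  qed
qed

lemma inner_le_dual_norm:
  fixes nrm :: "'a::euclidean_space \<Rightarrow> real"
  assumes n: "is_norm nrm"
  shows "x \<bullet> y \<le> dual_norm nrm x * nrm y"
proof (cases "y = 0")
  case True
  then show ?thesis by (simp add: is_normD(2)[OF n])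
next
  case False
  then have pos: "0 < nrm y"
    by (rule is_normD(3)[OF n])
  then have "nrm (inverse (nrm y) *\<^sub>R y) \<le> 1"
    by (subst is_normD(4)[OF n]) simp
  then have "x \<bullet> (inverse (nrm y) *\<^sub>R y) \<le> dual_norm nrm x"
    unfolding dual_norm_def
    by (intro cSUP_upper[OF _ dual_norm_bdd_above[OF n, of x]]) simp
  then have "(x \<bullet> y) / nrm y \<le> dual_norm nrm x"
    by (simp add: divide_inverse mult.commute)
  then show ?thesis using pos by (simp add: pos_divide_le_eq)
qed

lemma abs_inner_le_dual_norm:
  fixes nrm :: "'a::euclidean_space \<Rightarrow> real"
  assumes "is_norm nrm"
  shows "\<bar>x \<bullet> y\<bar> \<le> dual_norm nrm x * nrm y"
  using inner_le_dual_norm[OF assms, of x y] inner_le_dual_norm[OF assms, of x "- y"]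
  by (simp add: is_norm_minus[OF assms] abs_le_iff)

lemma dual_norm_nonneg:
  fixes nrm :: "'a::euclidean_space \<Rightarrow> real"
  assumes n: "is_norm nrm"
  shows "0 \<le> dual_norm nrm x"
proof -
  have "nrm 0 \<le> 1" by (simp add: is_normD(2)[OF n])
  then have "x \<bullet> 0 \<le> dual_norm nrm x"
    unfolding dual_norm_def
    using cSUP_upper[OF _ dual_norm_bdd_above[OF n, of x]] by blast
  then show ?thesis by simp
qed

text \<open>As a pointwise supremum of linear functions, everywhere finite, the dual norm is convex, hence continuous.\<close>

lemma dual_norm_measurable:
  fixes nrm :: "'a::euclidean_space \<Rightarrow> real"
  assumes n: "is_norm nrm"
  shows "dual_norm nrm \<in> borel_measurable borel"
proof -
  have "nrm 0 \<le> 1" by (simp add: is_normD(2)[OF n])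
  then have ne: "{y. nrm y \<le> 1} \<noteq> {}" by blast
  have le: "x \<bullet> y \<le> dual_norm nrm x" if "nrm y \<le> 1" for x y
    using cSUP_upper[OF _ dual_norm_bdd_above[OF n, of x]] that
    unfolding dual_norm_def by blast
  have "convex_on UNIV (dual_norm nrm)"
  proof (rule convex_onI)
    fix t :: real and x y :: 'a
    assume t: "0 < t" "t < 1"
    show "dual_norm nrm ((1 - t) *\<^sub>R x + t *\<^sub>R y)
        \<le> (1 - t) * dual_norm nrm x + t * dual_norm nrm y"
      unfolding dual_norm_def[of nrm "_ + _"]
    proof (rule cSUP_least[OF ne])
      fix w assume "w \<in> {y. nrm y \<le> 1}"
      then have "x \<bullet> w \<le> dual_norm nrm x" "y \<bullet> w \<le> dual_norm nrm y"
        by (auto intro: le)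
      then show "((1 - t) *\<^sub>R x + t *\<^sub>R y) \<bullet> w \<le> (1 - t) * dual_norm nrm x + t * dual_norm nrm y"
        using t by (auto simp: inner_add_left intro!: add_mono mult_left_mono)
    qed
  qed simp
  then have "continuous_on UNIV (dual_norm nrm)"
    by (rule convex_on_continuous[OF open_UNIV])
  then show ?thesis by (rule borel_measurable_continuous_onI)
qed

section \<open>Bregman divergences\<close>

lemma gradient_has_derivative:
  fixes R :: "'a::euclidean_space \<Rightarrow> real"
  assumes "open U" "R differentiable_on U" "x \<in> U"
  shows "(R has_derivative (\<lambda>h. gradient R x \<bullet> h)) (at x)"
proof -
  have "R differentiable (at x)"
    using assms(2,3) at_within_open[OF assms(3,1)] unfolding differentiable_on_def by metis
  then obtain L where L: "(R has_derivative L) (at x)"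
    unfolding differentiable_def by (elim exE)
  interpret bounded_linear L by (rule has_derivative_bounded_linear[OF L])
  define D where "D = (\<Sum>i\<in>Basis. L i *\<^sub>R i)"
  have "L h = h \<bullet> D" for h
  proof -
    have "L h = L (\<Sum>i\<in>Basis. (h \<bullet> i) *\<^sub>R i)" by (simp add: euclidean_representation)
    then show ?thesis by (simp add: sum scaleR D_def inner_sum_right mult.commute)
  qed
  then have D: "GDERIV R x :> D"
    unfolding gderiv_def using L by presburger
  moreover have "D' = D" if "GDERIV R x :> D'" for D'
  proof -
    have "(\<lambda>h. h \<bullet> D') = (\<lambda>h. h \<bullet> D)"
      using that D unfolding gderiv_def by (rule has_derivative_unique)
    then show ?thesis by (metis inner_commute vector_eq_ldot)
  qed
  ultimately have "gradient R x = D"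
    unfolding gradient_def by (rule the_equality)
  then show ?thesis using D by (simp add: gderiv_def inner_commute)
qed

lemma gradient_quotient_limit:
  fixes R :: "'a::euclidean_space \<Rightarrow> real"
  assumes "open U" "R differentiable_on U" "x \<in> U"
  shows "((\<lambda>u. (R (x + u *\<^sub>R v) - R x) / u) \<longlongrightarrow> gradient R x \<bullet> v) (at 0)"
proof -
  have "((\<lambda>u::real. x + u *\<^sub>R v) has_derivative (\<lambda>u. u *\<^sub>R v)) (at 0)"
    by (auto intro!: derivative_eq_intros)
  moreover have "(R has_derivative (\<lambda>h. gradient R x \<bullet> h)) (at (x + 0 *\<^sub>R v))"
    using gradient_has_derivative[OF assms] by simp
  ultimately have "((\<lambda>u. R (x + u *\<^sub>R v)) has_derivative (\<lambda>u. gradient R x \<bullet> (u *\<^sub>R v))) (at 0)"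
    by (rule has_derivative_compose)
  then have "((\<lambda>u. R (x + u *\<^sub>R v)) has_real_derivative gradient R x \<bullet> v) (at 0)"
    by (simp add: has_field_derivative_def mult_commute_abs)
  then show ?thesis by (simp add: DERIV_def)
qed

text \<open>Strong convexity bounds the difference quotients of \<open>R\<close> at \<open>y\<close> in the direction of \<open>x\<close>; the
  derivative at \<open>y\<close> is their limit.\<close>

lemma bregman_lower_bound:
  fixes R :: "'a::euclidean_space \<Rightarrow> real"
  assumes U: "open U" "R differentiable_on U" and sc: "strongly_convex_on nrm U \<sigma> R"
    and xy: "x \<in> U" "y \<in> U"
  shows "\<sigma> / 2 * (nrm (x - y))\<^sup>2 \<le> bregman R x y"
proof -
  let ?q = "\<lambda>u. (R (y + u *\<^sub>R (x - y)) - R y) / u"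
  have "((\<lambda>u. R x - R y - \<sigma> / 2 * (1 - u) * (nrm (x - y))\<^sup>2)
      \<longlongrightarrow> R x - R y - \<sigma> / 2 * (1 - 0) * (nrm (x - y))\<^sup>2) (at_right 0)"
    by (intro tendsto_intros)
  moreover have "(?q \<longlongrightarrow> gradient R y \<bullet> (x - y)) (at_right 0)"
    using gradient_quotient_limit[OF U xy(2)] by (rule filterlim_mono) (auto simp: at_le)
  moreover have "\<forall>\<^sub>F u in at_right 0. ?q u \<le> R x - R y - \<sigma> / 2 * (1 - u) * (nrm (x - y))\<^sup>2"
    unfolding eventually_at_right_field
  proof (intro exI[of _ 1] conjI allI impI)
    fix u :: real assume u: "0 < u" "u < 1"
    have "R (u *\<^sub>R x + (1 - u) *\<^sub>R y)
        \<le> u * R x + (1 - u) * R y - \<sigma> / 2 * u * (1 - u) * (nrm (x - y))\<^sup>2"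
      using sc u xy by (auto simp: strongly_convex_on_def)
    moreover have "u *\<^sub>R x + (1 - u) *\<^sub>R y = y + u *\<^sub>R (x - y)"
      by (simp add: algebra_simps)
    ultimately have "R (y + u *\<^sub>R (x - y)) - R y
        \<le> u * (R x - R y - \<sigma> / 2 * (1 - u) * (nrm (x - y))\<^sup>2)"
      by (simp add: algebra_simps)
    then show "?q u \<le> R x - R y - \<sigma> / 2 * (1 - u) * (nrm (x - y))\<^sup>2"
      using u by (simp add: field_simps)
  qed simp
  ultimately have "gradient R y \<bullet> (x - y) \<le> R x - R y - \<sigma> / 2 * (1 - 0) * (nrm (x - y))\<^sup>2"
    by (intro tendsto_le[of "at_right (0::real)"]) auto
  then show ?thesis by (simp add: bregman_def)
qed

lemma bregman_nonneg:
  fixes R :: "'a::euclidean_space \<Rightarrow> real"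
  assumes "open U" "R differentiable_on U" "strongly_convex_on nrm U \<sigma> R" "x \<in> U" "y \<in> U"
  shows "0 \<le> bregman R x y"
proof -
  have "0 \<le> \<sigma> / 2 * (nrm (x - y))\<^sup>2"
    using assms(3) by (simp add: strongly_convex_on_def)
  then show ?thesis using bregman_lower_bound[OF assms] by linarith
qed

text \<open>A convex differentiable function has bounded gradient on a compact subset of its open
  domain: a gradient of norm \<open>m\<close> at a point whose \<open>r\<close>-ball lies in the domain forces an increase
  of at least \<open>r * m\<close> within that ball, and \<open>R\<close> is bounded on the compact union of these balls. The
  divergence is bounded along with the gradient.\<close>

lemma bregman_bdd_above:
  fixes R :: "'a::euclidean_space \<Rightarrow> real"
  assumes U: "open U" "R differentiable_on U" and sc: "strongly_convex_on nrm U \<sigma> R"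
    and X: "compact X" "X \<subseteq> U"
  shows "bdd_above ((\<lambda>(x, y). bregman R x y) ` (X \<times> X))"
proof (cases "X = {}")
  case False
  have "\<exists>r>0. (\<Union>x\<in>X. cball x r) \<subseteq> U"
    by (rule compact_subset_open_imp_cball_epsilon_subset[OF X(1) U(1) X(2)]) (intro exI conjI)
  then obtain r where r: "0 < r" "(\<Union>x\<in>X. cball x r) \<subseteq> U"
    by (elim exE conjE)
  define K where "K = (\<Union>x\<in>X. cball x r)"
  have "K = {x + y | x y. x \<in> X \<and> y \<in> cball 0 r}"
  proof
    show "K \<subseteq> {x + y | x y. x \<in> X \<and> y \<in> cball 0 r}"
    proof
      fix w assume "w \<in> K"
      then obtain x where "x \<in> X" "dist x w \<le> r" by (auto simp: K_def)
      then have "x \<in> X \<and> w - x \<in> cball 0 r \<and> w = x + (w - x)"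
        by (simp add: dist_norm norm_minus_commute)
      then show "w \<in> {x + y | x y. x \<in> X \<and> y \<in> cball 0 r}" by blast
    qed
  qed (auto simp: K_def dist_norm)
  then have "compact K"
    using compact_sums[OF X(1) compact_cball[of 0 r]] by simp
  moreover have "continuous_on K R"
    using differentiable_imp_continuous_on[OF U(2)] r(2) continuous_on_subset K_def by blast
  ultimately have "bounded (R ` K)"
    using compact_continuous_image compact_imp_bounded by blast
  then obtain k where k: "\<And>w. w \<in> K \<Longrightarrow> \<bar>R w\<bar> \<le> k"
    by (auto simp: bounded_iff)
  have XK: "X \<subseteq> K" using r(1) by (force simp: K_def)
  obtain d where d: "\<forall>x\<in>X. \<forall>y\<in>X. norm (x - y) \<le> d"
    using compact_imp_bounded[OF X(1)] unfolding bounded_two_points dist_norm by auto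
  have grad: "norm (gradient R y) \<le> 2 * k / r" if "y \<in> X" for y
  proof (cases "gradient R y = 0")
    case True
    then show ?thesis using k[of y] XK that r(1) by auto
  next
    case False
    let ?w = "y + (r / norm (gradient R y)) *\<^sub>R gradient R y"
    have w: "?w \<in> K"
      using that r(1) False by (auto simp: K_def dist_norm intro!: bexI[of _ y])
    then have "0 \<le> bregman R ?w y"
      using r(2) XK that unfolding K_def[symmetric] by (intro bregman_nonneg[OF U sc]) auto
    then have "r * norm (gradient R y) \<le> R ?w - R y"
      using False by (simp add: bregman_def power2_norm_eq_inner[symmetric] power2_eq_square)
    also have "\<dots> \<le> 2 * k" using k[OF w] k[of y] XK that by auto
    finally show ?thesis using r(1) by (simp add: field_simps)
  qed
  show ?thesis
  proof (rule bdd_aboveI2)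
    fix p assume "p \<in> X \<times> X"
    then obtain x y where p: "p = (x, y)" "x \<in> X" "y \<in> X" by auto
    have "\<bar>gradient R y \<bullet> (x - y)\<bar> \<le> norm (gradient R y) * norm (x - y)"
      by (rule Cauchy_Schwarz_ineq2)
    also have "\<dots> \<le> 2 * k / r * d"
      using grad[OF p(3)] d p(2,3) by (intro mult_mono) (auto intro: order_trans[OF norm_ge_zero])
    finally show "(case p of (x, y) \<Rightarrow> bregman R x y) \<le> 2 * k + 2 * k / r * d"
      using k[of x] k[of y] XK p unfolding bregman_def prod.case p(1) by (auto simp: abs_le_iff subset_iff)
  qed
qed simp

text \<open>The first-order optimality condition of the mirror step, in the three-point form: moving
  from the minimizer \<open>x'\<close> towards any \<open>y \<in> X\<close> cannot decrease the objective to first order, and the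
  resulting difference of gradients paired with \<open>y - x'\<close> is a combination of three divergences.\<close>

lemma mirror_step_three_point:
  fixes R :: "'a::euclidean_space \<Rightarrow> real"
  assumes U: "open U" "R differentiable_on U" and X: "convex X" "X \<subseteq> U"
    and a: "0 < a" and x: "x \<in> X"
    and step: "is_arg_min (\<lambda>y. \<gamma> \<bullet> (y - x) + 1 / a * bregman R y x) (\<lambda>y. y \<in> X) x'"
    and y: "y \<in> X"
  shows "a * (\<gamma> \<bullet> (x' - y)) \<le> bregman R y x - bregman R y x' - bregman R x' x"
proof -
  have x': "x' \<in> X" using step by (simp add: is_arg_min_def)
  let ?q = "\<lambda>u. (R (x' + u *\<^sub>R (y - x')) - R x') / u"
  have "(?q \<longlongrightarrow> gradient R x' \<bullet> (y - x')) (at_right 0)"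
    using gradient_quotient_limit[OF U, of x'] x' X(2)
    by (intro filterlim_mono[OF gradient_quotient_limit[OF U, of x']]) (auto simp: at_le)
  moreover have "\<forall>\<^sub>F u in at_right 0. gradient R x \<bullet> (y - x') - a * (\<gamma> \<bullet> (y - x')) \<le> ?q u"
    unfolding eventually_at_right_field
  proof (intro exI[of _ 1] conjI allI impI)
    fix u :: real assume u: "0 < u" "u < 1"
    let ?w = "x' + u *\<^sub>R (y - x')"
    have "?w = (1 - u) *\<^sub>R x' + u *\<^sub>R y" by (simp add: algebra_simps)
    then have "?w \<in> X" using X(1) x' y u by (simp add: convex_alt)
    then have "\<gamma> \<bullet> (x' - x) + 1 / a * bregman R x' x \<le> \<gamma> \<bullet> (?w - x) + 1 / a * bregman R ?w x"
      using step unfolding is_arg_min_def by (meson not_le)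
    then have "a * (\<gamma> \<bullet> (x' - x) + 1 / a * bregman R x' x) \<le> a * (\<gamma> \<bullet> (?w - x) + 1 / a * bregman R ?w x)"
      using a by (intro mult_left_mono) auto
    then have "a * (\<gamma> \<bullet> (x' - x)) + bregman R x' x \<le> a * (\<gamma> \<bullet> (?w - x)) + bregman R ?w x"
      using a by (simp add: distrib_left)
    then have "u * (gradient R x \<bullet> (y - x') - a * (\<gamma> \<bullet> (y - x'))) \<le> R ?w - R x'"
      by (simp add: bregman_def inner_simps algebra_simps)
    then show "gradient R x \<bullet> (y - x') - a * (\<gamma> \<bullet> (y - x')) \<le> ?q u"
      using u by (simp add: field_simps)
  qed simp
  ultimately have "gradient R x \<bullet> (y - x') - a * (\<gamma> \<bullet> (y - x')) \<le> gradient R x' \<bullet> (y - x')"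
    by (intro tendsto_lowerbound[of _ _ "at_right (0::real)"]) auto
  then show ?thesis by (simp add: bregman_def inner_simps algebra_simps)
qed

text \<open>Strong convexity provides the term \<open>\<sigma> / 2 * (nrm (x' - x))\<^sup>2\<close> that pays, by the inequality
  \<open>2 * u * v \<le> u\<^sup>2 + v\<^sup>2\<close>, for evaluating \<open>\<gamma>\<close> at \<open>x\<close> instead of at the new point \<open>x'\<close>.\<close>

lemma mirror_step_descent:
  fixes R :: "'a::euclidean_space \<Rightarrow> real"
  assumes n: "is_norm nrm"
    and U: "open U" "R differentiable_on U" and sc: "strongly_convex_on nrm U \<sigma> R"
    and X: "convex X" "X \<subseteq> U"
    and a: "0 < a" and x: "x \<in> X"
    and step: "is_arg_min (\<lambda>y. \<gamma> \<bullet> (y - x) + 1 / a * bregman R y x) (\<lambda>y. y \<in> X) x'"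
    and y: "y \<in> X"
  shows "a * (\<gamma> \<bullet> (x - y)) - a\<^sup>2 / (2 * \<sigma>) * (dual_norm nrm \<gamma>)\<^sup>2
    \<le> bregman R y x - bregman R y x'"
proof -
  have \<sigma>: "0 < \<sigma>" using sc by (simp add: strongly_convex_on_def)
  have x': "x' \<in> X" using step by (simp add: is_arg_min_def)
  let ?d = "nrm (x' - x)" and ?G = "dual_norm nrm \<gamma>"
  have "a * (\<gamma> \<bullet> (x' - y)) \<le> bregman R y x - bregman R y x' - \<sigma> / 2 * ?d\<^sup>2"
    using mirror_step_three_point[OF U X a x step y] bregman_lower_bound[OF U sc, of x' x] X x x'
    by force
  moreover have "a * (\<gamma> \<bullet> (x - x')) \<le> a * (?G * ?d)"
    using inner_le_dual_norm[OF n, of \<gamma> "x - x'"] is_norm_minus[OF n, of "x - x'"] a by simp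
  moreover have "a * (?G * ?d) \<le> a\<^sup>2 / (2 * \<sigma>) * ?G\<^sup>2 + \<sigma> / 2 * ?d\<^sup>2"
  proof -
    have "0 \<le> (a * ?G - \<sigma> * ?d)\<^sup>2 / (2 * \<sigma>)" using \<sigma> by simp
    also have "\<dots> = a\<^sup>2 / (2 * \<sigma>) * ?G\<^sup>2 + \<sigma> / 2 * ?d\<^sup>2 - a * (?G * ?d)"
      using \<sigma> by (simp add: power2_eq_square field_simps)
    finally show ?thesis by simp
  qed
  moreover have "a * (\<gamma> \<bullet> (x - y)) = a * (\<gamma> \<bullet> (x - x')) + a * (\<gamma> \<bullet> (x' - y))"
    by (simp add: inner_diff_right algebra_simps)
  ultimately show ?thesis by linarith
qed

text \<open>Pointwise, the gradient is a limit of difference quotients of \<open>R\<close>; extending \<open>R\<close> by zero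
  outside \<open>U\<close> turns these into Borel functions on the whole space.\<close>

lemma bregman_measurable:
  fixes R :: "'a::euclidean_space \<Rightarrow> real"
  assumes U: "open U" "R differentiable_on U"
    and Y: "Y \<in> borel_measurable N" "\<And>\<omega>. \<omega> \<in> space N \<Longrightarrow> Y \<omega> \<in> U"
  shows "(\<lambda>\<omega>. bregman R y (Y \<omega>)) \<in> borel_measurable N"
proof -
  note [measurable] = Y(1)
  define R' where "R' = (\<lambda>w. indicator U w *\<^sub>R R w)"
  have [measurable]: "R' \<in> borel_measurable borel"
    unfolding R'_def using differentiable_imp_continuous_on[OF U(2)] U(1)
    by (intro borel_measurable_continuous_on_indicator) auto
  have "(\<lambda>\<omega>. gradient R (Y \<omega>) \<bullet> i) \<in> borel_measurable N" for i
  proof (rule borel_measurable_LIMSEQ_real)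
    fix \<omega> assume "\<omega> \<in> space N"
    then have y: "Y \<omega> \<in> U" by (rule Y(2))
    let ?u = "\<lambda>n. inverse (real (Suc n))"
    have u: "filterlim ?u (at 0) sequentially"
      unfolding filterlim_at using LIMSEQ_inverse_real_of_nat by auto
    have "(\<lambda>n. Y \<omega> + ?u n *\<^sub>R i) \<longlonglongrightarrow> Y \<omega> + 0 *\<^sub>R i"
      by (intro tendsto_intros LIMSEQ_inverse_real_of_nat)
    then have "\<forall>\<^sub>F n in sequentially. Y \<omega> + ?u n *\<^sub>R i \<in> U"
      by (rule topological_tendstoD) (use U y in auto)
    then have "\<forall>\<^sub>F n in sequentially. (R (Y \<omega> + ?u n *\<^sub>R i) - R (Y \<omega>)) / ?u n
        = (R' (Y \<omega> + ?u n *\<^sub>R i) - R' (Y \<omega>)) / ?u n"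
      by eventually_elim (simp add: R'_def y)
    moreover have "(\<lambda>n. (R (Y \<omega> + ?u n *\<^sub>R i) - R (Y \<omega>)) / ?u n) \<longlonglongrightarrow> gradient R (Y \<omega>) \<bullet> i"
      by (rule filterlim_compose[OF gradient_quotient_limit[OF U y] u])
    ultimately show "(\<lambda>n. (R' (Y \<omega> + ?u n *\<^sub>R i) - R' (Y \<omega>)) / ?u n) \<longlonglongrightarrow> gradient R (Y \<omega>) \<bullet> i"
      by (simp cong: filterlim_cong add: Lim_transform_eventually)
  qed measurable
  then have [measurable]: "(\<lambda>\<omega>. gradient R (Y \<omega>)) \<in> borel_measurable N"
    by (simp add: borel_measurable_euclidean_space[where f = "\<lambda>\<omega>. gradient R (Y \<omega>)"])
  have "(\<lambda>\<omega>. R y - R' (Y \<omega>) - gradient R (Y \<omega>) \<bullet> (y - Y \<omega>)) \<in> borel_measurable N"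
    by measurable
  then show ?thesis
    by (rule measurable_cong[THEN iffD1, rotated]) (simp add: bregman_def R'_def Y(2))
qed

section \<open>Conditional expectations of square-integrable variables\<close>

lemma integrable_product_of_squares:
  fixes f g :: "'w \<Rightarrow> real"
  assumes [measurable]: "f \<in> borel_measurable M" "g \<in> borel_measurable M"
    and "integrable M (\<lambda>\<omega>. (f \<omega>)\<^sup>2)" "integrable M (\<lambda>\<omega>. (g \<omega>)\<^sup>2)"
  shows "integrable M (\<lambda>\<omega>. f \<omega> * g \<omega>)"
proof (rule Bochner_Integration.integrable_bound)
  show "integrable M (\<lambda>\<omega>. (f \<omega>)\<^sup>2 + (g \<omega>)\<^sup>2)" using assms by simp
  have "\<bar>f \<omega> * g \<omega>\<bar> \<le> (f \<omega>)\<^sup>2 + (g \<omega>)\<^sup>2" for \<omega>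
  proof -
    have "0 \<le> \<bar>f \<omega>\<bar> * \<bar>g \<omega>\<bar>" by simp
    moreover have "2 * \<bar>f \<omega>\<bar> * \<bar>g \<omega>\<bar> \<le> (f \<omega>)\<^sup>2 + (g \<omega>)\<^sup>2"
      using sum_squares_bound[of "\<bar>f \<omega>\<bar>" "\<bar>g \<omega>\<bar>"] by simp
    ultimately show ?thesis unfolding abs_mult by linarith
  qed
  then show "AE \<omega> in M. norm (f \<omega> * g \<omega>) \<le> norm ((f \<omega>)\<^sup>2 + (g \<omega>)\<^sup>2)" by simp
qed measurable

lemma real_cond_exp_square:
  assumes P: "prob_space M" and F: "subalgebra M F"
    and [measurable]: "h \<in> borel_measurable M" and h: "integrable M (\<lambda>\<omega>. (h \<omega>)\<^sup>2)"
  shows "integrable M (\<lambda>\<omega>. (real_cond_exp M F h \<omega>)\<^sup>2)"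
    and "(\<integral>\<omega>. (real_cond_exp M F h \<omega>)\<^sup>2 \<partial>M) \<le> (\<integral>\<omega>. (h \<omega>)\<^sup>2 \<partial>M)"
proof -
  interpret prob_space M by (rule P)
  interpret finite_measure_subalgebra M F by unfold_locales (rule F)
  have hi: "integrable M h" by (rule square_integrable_imp_integrable[OF _ h]) measurable
  have J: "AE \<omega> in M. (real_cond_exp M F h \<omega>)\<^sup>2 \<le> real_cond_exp M F (\<lambda>\<omega>. (h \<omega>)\<^sup>2) \<omega>"
    by (rule real_cond_exp_jensens_inequality(2)[where I = UNIV])
      (auto simp: hi h convex_power2)
  show I: "integrable M (\<lambda>\<omega>. (real_cond_exp M F h \<omega>)\<^sup>2)"
    by (rule Bochner_Integration.integrable_bound[OF real_cond_exp_int(1)[OF h]])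
      (use J in auto)
  have "(\<integral>\<omega>. (real_cond_exp M F h \<omega>)\<^sup>2 \<partial>M) \<le> (\<integral>\<omega>. real_cond_exp M F (\<lambda>\<omega>. (h \<omega>)\<^sup>2) \<omega> \<partial>M)"
    by (rule integral_mono_AE[OF I real_cond_exp_int(1)[OF h] J])
  then show "(\<integral>\<omega>. (real_cond_exp M F h \<omega>)\<^sup>2 \<partial>M) \<le> (\<integral>\<omega>. (h \<omega>)\<^sup>2 \<partial>M)"
    by (simp add: real_cond_exp_int(2)[OF h])
qed

text \<open>The difference of two nested conditional expectations of \<open>h\<close> is, up to sign, a projection of \<open>h\<close>
  in \<open>L\<^sup>2\<close>: it has mean zero given the smaller algebra, and no larger second moment than \<open>h\<close>.\<close>

lemma nested_cond_exp_increment: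
  assumes P: "prob_space M" and G: "subalgebra M G" and FG: "subalgebra G F"
    and h_meas[measurable]: "h \<in> borel_measurable M" and h: "integrable M (\<lambda>\<omega>. (h \<omega>)\<^sup>2)"
  defines "d \<equiv> \<lambda>\<omega>. real_cond_exp M F h \<omega> - real_cond_exp M G h \<omega>"
  shows "integrable M (\<lambda>\<omega>. (d \<omega>)\<^sup>2)"
    and "(\<integral>\<omega>. (d \<omega>)\<^sup>2 \<partial>M) \<le> (\<integral>\<omega>. (h \<omega>)\<^sup>2 \<partial>M)"
    and "AE \<omega> in M. real_cond_exp M F d \<omega> = 0"
proof -
  interpret prob_space M by (rule P)
  have F: "subalgebra M F" using G FG by (auto simp: subalgebra_def)
  interpret F: finite_measure_subalgebra M F by unfold_locales (rule F)
  interpret G: finite_measure_subalgebra M G by unfold_locales (rule G)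
  have hi: "integrable M h" by (rule square_integrable_imp_integrable[OF _ h]) measurable
  let ?c = "real_cond_exp M F h" and ?e = "real_cond_exp M G h"
  note c = real_cond_exp_square[OF P F h_meas h] and e = real_cond_exp_square[OF P G h_meas h]
  have cG: "?c \<in> borel_measurable G"
    by (rule measurable_from_subalg[OF FG borel_measurable_cond_exp])
  have ce: "integrable M (\<lambda>\<omega>. ?c \<omega> * ?e \<omega>)" and ch: "integrable M (\<lambda>\<omega>. ?c \<omega> * h \<omega>)"
    by (auto intro!: integrable_product_of_squares c(1) e(1) h)
  have sq: "(\<lambda>\<omega>. (d \<omega>)\<^sup>2) = (\<lambda>\<omega>. (?e \<omega>)\<^sup>2 - 2 * (?c \<omega> * ?e \<omega>) + (?c \<omega>)\<^sup>2)"
    by (auto simp: d_def power2_eq_square algebra_simps)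
  show "integrable M (\<lambda>\<omega>. (d \<omega>)\<^sup>2)"
    unfolding sq using c(1) e(1) ce by simp
  have "(\<integral>\<omega>. ?c \<omega> * ?e \<omega> \<partial>M) = (\<integral>\<omega>. ?c \<omega> * h \<omega> \<partial>M)"
    by (rule G.real_cond_exp_intg(2)[OF ch cG h_meas])
  also have "\<dots> = (\<integral>\<omega>. ?c \<omega> * ?c \<omega> \<partial>M)"
    by (rule F.real_cond_exp_intg(2)[OF ch borel_measurable_cond_exp h_meas, symmetric])
  finally have "(\<integral>\<omega>. (d \<omega>)\<^sup>2 \<partial>M) = (\<integral>\<omega>. (?e \<omega>)\<^sup>2 \<partial>M) - (\<integral>\<omega>. (?c \<omega>)\<^sup>2 \<partial>M)"
    unfolding sq using c(1) e(1) ce by (simp add: power2_eq_square)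
  moreover have "0 \<le> (\<integral>\<omega>. (?c \<omega>)\<^sup>2 \<partial>M)" by simp
  ultimately show "(\<integral>\<omega>. (d \<omega>)\<^sup>2 \<partial>M) \<le> (\<integral>\<omega>. (h \<omega>)\<^sup>2 \<partial>M)" using e(2) by linarith
  have "AE \<omega> in M. real_cond_exp M F d \<omega>
      = real_cond_exp M F ?c \<omega> - real_cond_exp M F ?e \<omega>"
    unfolding d_def by (rule F.real_cond_exp_diff[OF F.real_cond_exp_int(1)[OF hi] G.real_cond_exp_int(1)[OF hi]])
  moreover have "AE \<omega> in M. real_cond_exp M F ?c \<omega> = ?c \<omega>"
    by (rule F.real_cond_exp_F_meas[OF F.real_cond_exp_int(1)[OF hi] borel_measurable_cond_exp])
  moreover have "AE \<omega> in M. real_cond_exp M F ?e \<omega> = ?c \<omega>"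
    by (rule F.real_cond_exp_nested_subalg[OF G FG hi])
  ultimately show "AE \<omega> in M. real_cond_exp M F d \<omega> = 0" by eventually_elim simp
qed

text \<open>Each partial sum is known when the next centred term is drawn, so pulling it out of the
  conditional expectation makes the mixed term vanish and the second moments add up.\<close>

lemma martingale_difference_second_moment:
  fixes a :: "nat \<Rightarrow> real"
  assumes P: "prob_space M" and F: "\<And>k. 1 \<le> k \<Longrightarrow> subalgebra M (F k)"
    and adapted: "\<And>j k. 1 \<le> j \<Longrightarrow> j < k \<Longrightarrow> d j \<in> borel_measurable (F k)"
    and sq: "\<And>k. 1 \<le> k \<Longrightarrow> integrable M (\<lambda>\<omega>. (d k \<omega>)\<^sup>2)"
    and centred: "\<And>k. 1 \<le> k \<Longrightarrow> AE \<omega> in M. real_cond_exp M (F k) (d k) \<omega> = 0"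
  shows "integrable M (\<lambda>\<omega>. (\<Sum>k=1..t. a k * d k \<omega>)\<^sup>2) \<and>
    (\<integral>\<omega>. (\<Sum>k=1..t. a k * d k \<omega>)\<^sup>2 \<partial>M) = (\<Sum>k=1..t. (a k)\<^sup>2 * (\<integral>\<omega>. (d k \<omega>)\<^sup>2 \<partial>M))"
proof (induction t)
  case (Suc t)
  interpret prob_space M by (rule P)
  interpret F: finite_measure_subalgebra M "F (Suc t)" by unfold_locales (simp add: F)
  let ?S = "\<lambda>\<omega>. \<Sum>k=1..t. a k * d k \<omega>" and ?d = "d (Suc t)"
  have S_meas: "?S \<in> borel_measurable (F (Suc t))"
    by (intro borel_measurable_sum borel_measurable_times adapted) auto
  have d_meas: "?d \<in> borel_measurable M"
    by (rule measurable_from_subalg[OF F[of "Suc (Suc t)"] adapted]) auto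
  have S_meas': "?S \<in> borel_measurable M"
    by (rule measurable_from_subalg[OF F S_meas]) simp
  have Sd: "integrable M (\<lambda>\<omega>. ?S \<omega> * ?d \<omega>)"
    using Suc.IH by (intro integrable_product_of_squares S_meas' d_meas sq) auto
  have "(\<integral>\<omega>. ?S \<omega> * ?d \<omega> \<partial>M) = (\<integral>\<omega>. ?S \<omega> * real_cond_exp M (F (Suc t)) ?d \<omega> \<partial>M)"
    by (rule F.real_cond_exp_intg(2)[OF Sd S_meas d_meas, symmetric])
  also have "\<dots> = (\<integral>\<omega>. 0 \<partial>M)"
    by (rule integral_cong_AE)
      (use S_meas' centred[of "Suc t"] in \<open>auto intro!: borel_measurable_times borel_measurable_cond_exp2\<close>)
  finally have zero: "(\<integral>\<omega>. ?S \<omega> * ?d \<omega> \<partial>M) = 0" by simp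
  have sum: "(\<lambda>\<omega>. (\<Sum>k=1..Suc t. a k * d k \<omega>)\<^sup>2)
      = (\<lambda>\<omega>. (?S \<omega>)\<^sup>2 + 2 * a (Suc t) * (?S \<omega> * ?d \<omega>) + (a (Suc t))\<^sup>2 * (?d \<omega>)\<^sup>2)"
    by (rule ext) (simp add: power2_sum power_mult_distrib algebra_simps)
  show ?case
    unfolding sum using Suc.IH Sd sq[of "Suc t"] zero by simp
qed simp

text \<open>The vector-valued conditional expectation is defined by coordinates, so known vectors can be
  pulled out of an inner product coordinate by coordinate.\<close>

lemma real_cond_exp_inner:
  fixes h u :: "'w \<Rightarrow> 'a::euclidean_space"
  assumes P: "prob_space M" and F: "subalgebra M F"
    and h: "h \<in> borel_measurable M" "\<And>i. integrable M (\<lambda>\<omega>. h \<omega> \<bullet> i)"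
    and u: "u \<in> borel_measurable F" "\<And>\<omega>. \<omega> \<in> space M \<Longrightarrow> norm (u \<omega>) \<le> C"
  shows "AE \<omega> in M. real_cond_exp M F (\<lambda>\<omega>. h \<omega> \<bullet> u \<omega>) \<omega> = vector_cond_exp M F h \<omega> \<bullet> u \<omega>"
proof -
  interpret prob_space M by (rule P)
  interpret finite_measure_subalgebra M F by unfold_locales (rule F)
  have uM[measurable]: "u \<in> borel_measurable M" by (rule measurable_from_subalg[OF F u(1)])
  note [measurable] = h(1) u(1)
  have int: "integrable M (\<lambda>\<omega>. (u \<omega> \<bullet> i) * (h \<omega> \<bullet> i))" for i
  proof (rule Bochner_Integration.integrable_bound)
    show "integrable M (\<lambda>\<omega>. C * norm i * (h \<omega> \<bullet> i))" using h(2) by simp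
    show "AE \<omega> in M. norm ((u \<omega> \<bullet> i) * (h \<omega> \<bullet> i)) \<le> norm (C * norm i * (h \<omega> \<bullet> i))"
    proof (rule AE_I2)
      fix \<omega> assume w: "\<omega> \<in> space M"
      have "\<bar>u \<omega> \<bullet> i\<bar> \<le> norm (u \<omega>) * norm i" by (rule Cauchy_Schwarz_ineq2)
      also have "\<dots> \<le> C * norm i" using u(2)[OF w] by (simp add: mult_right_mono)
      also have "\<dots> \<le> \<bar>C * norm i\<bar>" by simp
      finally show "norm ((u \<omega> \<bullet> i) * (h \<omega> \<bullet> i)) \<le> norm (C * norm i * (h \<omega> \<bullet> i))"
        by (simp add: abs_mult mult_right_mono)
    qed
  qed measurable
  have inner: "(\<lambda>\<omega>. \<Sum>i\<in>Basis. (u \<omega> \<bullet> i) * (h \<omega> \<bullet> i)) = (\<lambda>\<omega>. h \<omega> \<bullet> u \<omega>)"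
    by (rule ext) (subst euclidean_inner, simp add: mult.commute)
  have "AE \<omega> in M. \<forall>i\<in>Basis. real_cond_exp M F (\<lambda>\<omega>. (u \<omega> \<bullet> i) * (h \<omega> \<bullet> i)) \<omega>
      = (u \<omega> \<bullet> i) * real_cond_exp M F (\<lambda>\<omega>. h \<omega> \<bullet> i) \<omega>"
    by (subst AE_finite_all) (auto intro!: real_cond_exp_mult int)
  moreover have "AE \<omega> in M. real_cond_exp M F (\<lambda>\<omega>. \<Sum>i\<in>Basis. (u \<omega> \<bullet> i) * (h \<omega> \<bullet> i)) \<omega>
      = (\<Sum>i\<in>Basis. real_cond_exp M F (\<lambda>\<omega>. (u \<omega> \<bullet> i) * (h \<omega> \<bullet> i)) \<omega>)"
    by (rule real_cond_exp_sum[OF int])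
  ultimately show ?thesis
    unfolding inner
    by eventually_elim
      (simp add: vector_cond_exp_def inner_sum_right inner_commute[of _ "u _"] mult.commute)
qed

section \<open>The history filtration\<close>

lemma history_space: "space (history M x t) = space M"
  by (simp add: history_def space_measure_of_conv)

lemma history_sets:
  "sets (history M x t)
    = sigma_sets (space M) (\<Union>i\<in>{1..t}. {x i -` A \<inter> space M | A. A \<in> sets borel})"
  unfolding history_def by (rule sets_measure_of) auto

lemma history_subalgebra:
  assumes "\<And>i. 1 \<le> i \<Longrightarrow> i \<le> t \<Longrightarrow> x i \<in> borel_measurable M"
  shows "subalgebra M (history M x t)"
  unfolding subalgebra_def history_space history_sets
  using assms by (auto intro!: sets.sigma_sets_subset measurable_sets)

lemma history_mono:
  assumes "s \<le> t"
  shows "subalgebra (history M x t) (history M x s)"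
  unfolding subalgebra_def history_space history_sets
  by (intro conjI refl sigma_sets_mono' UN_mono) (use assms in auto)

lemma history_measurable:
  fixes x :: "nat \<Rightarrow> 'w \<Rightarrow> 'a::topological_space"
  assumes "1 \<le> i" "i \<le> t"
  shows "x i \<in> borel_measurable (history M x t)"
proof (rule measurableI)
  fix A :: "'a set" assume "A \<in> sets borel"
  then show "x i -` A \<inter> space (history M x t) \<in> sets (history M x t)"
    unfolding history_space history_sets using assms
    by (intro sigma_sets.Basic UN_I[of i]) auto
qed simp

section \<open>Conditioning the descent inequality\<close>

text \<open>The descent inequality with the noise made adapted. The variables \<open>h k\<close> may carry randomness
  that no \<open>F j\<close> sees: conditioning the inequality on \<open>F (k + 1)\<close> turns \<open>h k\<close> into a
  variable adapted to \<open>F\<close>, and the sum over \<open>k\<close> still telescopes because \<open>Y k - Y (k + 1)\<close> is left unchanged. Here \<open>N\<close>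
  collects the increments between the conditional expectations of \<open>h k\<close> given \<open>F k\<close> and
  \<open>F (k + 1)\<close>, and \<open>Q\<close> the conditioned quadratic terms.\<close>

lemma conditioned_descent:
  fixes a :: "nat \<Rightarrow> real"
  assumes P: "prob_space M"
    and F: "\<And>k. 1 \<le> k \<Longrightarrow> subalgebra M (F k)"
    and mono: "\<And>j k. 1 \<le> j \<Longrightarrow> j \<le> k \<Longrightarrow> subalgebra (F k) (F j)"
    and Y: "\<And>k. 1 \<le> k \<Longrightarrow> Y k \<in> borel_measurable (F k)"
      "\<And>k \<omega>. 1 \<le> k \<Longrightarrow> \<omega> \<in> space M \<Longrightarrow> 0 \<le> Y k \<omega> \<and> Y k \<omega> \<le> \<rho>"
    and h_meas: "\<And>k. 1 \<le> k \<Longrightarrow> h k \<in> borel_measurable M"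
    and s: "\<And>k. 1 \<le> k \<Longrightarrow> integrable M (s k)" "\<And>k. 1 \<le> k \<Longrightarrow> (\<integral>\<omega>. s k \<omega> \<partial>M) \<le> V"
      "\<And>k \<omega>. 0 \<le> s k \<omega>"
    and hs: "\<And>k \<omega>. 1 \<le> k \<Longrightarrow> \<omega> \<in> space M \<Longrightarrow> (h k \<omega>)\<^sup>2 \<le> C * s k \<omega>" and C: "0 \<le> C"
    and \<sigma>: "0 < \<sigma>"
    and step: "\<And>k \<omega>. 1 \<le> k \<Longrightarrow> \<omega> \<in> space M \<Longrightarrow>
      a k * h k \<omega> - (a k)\<^sup>2 / (2 * \<sigma>) * s k \<omega> \<le> Y k \<omega> - Y (Suc k) \<omega>"
  shows "\<exists>Q N. (AE \<omega> in M. (\<Sum>k=1..t. a k * real_cond_exp M (F k) (h k) \<omega>) \<le> \<rho> + Q \<omega> + N \<omega>) \<and>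
    (AE \<omega> in M. 0 \<le> Q \<omega>) \<and> integrable M Q \<and>
    (\<integral>\<omega>. Q \<omega> \<partial>M) \<le> V / (2 * \<sigma>) * (\<Sum>k=1..t. (a k)\<^sup>2) \<and>
    N \<in> borel_measurable M \<and> integrable M (\<lambda>\<omega>. (N \<omega>)\<^sup>2) \<and>
    (\<integral>\<omega>. (N \<omega>)\<^sup>2 \<partial>M) \<le> C * V * (\<Sum>k=1..t. (a k)\<^sup>2)"
proof -
  interpret prob_space M by (rule P)
  have hsq: "integrable M (\<lambda>\<omega>. (h k \<omega>)\<^sup>2)" "(\<integral>\<omega>. (h k \<omega>)\<^sup>2 \<partial>M) \<le> C * V" if k: "1 \<le> k" for k
  proof -
    note [measurable] = h_meas[OF k]
    have Cs: "integrable M (\<lambda>\<omega>. C * s k \<omega>)" using s(1)[OF k] by simp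
    show I: "integrable M (\<lambda>\<omega>. (h k \<omega>)\<^sup>2)"
      by (rule Bochner_Integration.integrable_bound[OF Cs])
        (auto intro!: AE_I2 order_trans[OF hs[OF k]])
    have "(\<integral>\<omega>. (h k \<omega>)\<^sup>2 \<partial>M) \<le> (\<integral>\<omega>. C * s k \<omega> \<partial>M)"
      by (rule integral_mono[OF I Cs hs[OF k]])
    also have "\<dots> \<le> C * V" using s(2)[OF k] C by (simp add: mult_left_mono)
    finally show "(\<integral>\<omega>. (h k \<omega>)\<^sup>2 \<partial>M) \<le> C * V" .
  qed
  let ?e = "\<lambda>k. real_cond_exp M (F (Suc k)) (h k)"
  let ?q = "\<lambda>k. real_cond_exp M (F (Suc k)) (s k)"
  define d where "d = (\<lambda>k \<omega>. real_cond_exp M (F k) (h k) \<omega> - ?e k \<omega>)"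
  define Q where "Q = (\<lambda>\<omega>. \<Sum>k=1..t. (a k)\<^sup>2 / (2 * \<sigma>) * ?q k \<omega>)"
  define N where "N = (\<lambda>\<omega>. \<Sum>k=1..t. a k * d k \<omega>)"

  have d: "integrable M (\<lambda>\<omega>. (d k \<omega>)\<^sup>2)" "(\<integral>\<omega>. (d k \<omega>)\<^sup>2 \<partial>M) \<le> C * V"
    "AE \<omega> in M. real_cond_exp M (F k) (d k) \<omega> = 0" if k: "1 \<le> k" for k
    using nested_cond_exp_increment[OF P F[of "Suc k"] mono[of k "Suc k"] h_meas[OF k] hsq(1)[OF k]]
      hsq(2)[OF k] k unfolding d_def by auto
  have d_meas: "d j \<in> borel_measurable (F k)" if "1 \<le> j" "j < k" for j k
    unfolding d_def
    by (intro borel_measurable_diff measurable_from_subalg[OF mono[of j k] borel_measurable_cond_exp]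
        measurable_from_subalg[OF mono[of "Suc j" k] borel_measurable_cond_exp]) (use that in auto)
  have N: "integrable M (\<lambda>\<omega>. (N \<omega>)\<^sup>2)"
    "(\<integral>\<omega>. (N \<omega>)\<^sup>2 \<partial>M) = (\<Sum>k=1..t. (a k)\<^sup>2 * (\<integral>\<omega>. (d k \<omega>)\<^sup>2 \<partial>M))"
    using martingale_difference_second_moment[of M F d a t, OF P F d_meas d(1) d(3)]
    unfolding N_def by auto
  note N(2)
  also have "(\<Sum>k=1..t. (a k)\<^sup>2 * (\<integral>\<omega>. (d k \<omega>)\<^sup>2 \<partial>M)) \<le> (\<Sum>k=1..t. (a k)\<^sup>2 * (C * V))"
    by (intro sum_mono mult_left_mono d(2)) auto
  finally have N2: "(\<integral>\<omega>. (N \<omega>)\<^sup>2 \<partial>M) \<le> C * V * (\<Sum>k=1..t. (a k)\<^sup>2)"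
    by (simp add: sum_distrib_left mult.commute)
  have N_meas: "N \<in> borel_measurable M"
    unfolding N_def d_def
    by (intro borel_measurable_sum borel_measurable_times borel_measurable_diff
        borel_measurable_cond_exp2 borel_measurable_const)

  have q: "integrable M (?q k)" "(\<integral>\<omega>. ?q k \<omega> \<partial>M) \<le> V" "AE \<omega> in M. 0 \<le> ?q k \<omega>"
    and descent: "AE \<omega> in M. a k * ?e k \<omega> - (a k)\<^sup>2 / (2 * \<sigma>) * ?q k \<omega> \<le> Y k \<omega> - Y (Suc k) \<omega>"
    if k: "1 \<le> k" for k
  proof -
    interpret F: finite_measure_subalgebra M "F (Suc k)" by unfold_locales (simp add: F)
    have hi: "integrable M (h k)"
      using square_integrable_imp_integrable[OF h_meas[OF k] hsq(1)[OF k]] .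
    note si = s(1)[OF k]
    show "integrable M (?q k)" "(\<integral>\<omega>. ?q k \<omega> \<partial>M) \<le> V"
      using F.real_cond_exp_int[OF si] s(2)[OF k] by auto
    show "AE \<omega> in M. 0 \<le> ?q k \<omega>"
      by (rule F.real_cond_exp_pos) (use s(3) si in auto)
    let ?L = "\<lambda>\<omega>. a k * h k \<omega> - (a k)\<^sup>2 / (2 * \<sigma>) * s k \<omega>"
    let ?W = "\<lambda>\<omega>. Y k \<omega> - Y (Suc k) \<omega>"
    have W_meas: "?W \<in> borel_measurable (F (Suc k))"
      by (intro borel_measurable_diff measurable_from_subalg[OF mono[of k "Suc k"] Y(1)] Y(1)) (use k in auto)
    have W: "integrable M ?W"
    proof (rule integrable_const_bound[of _ \<rho>])
      have "norm (?W \<omega>) \<le> \<rho>" if "\<omega> \<in> space M" for \<omega>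
        using Y(2)[OF k that] Y(2)[of "Suc k", OF _ that] by (auto simp: abs_le_iff)
      then show "AE \<omega> in M. norm (?W \<omega>) \<le> \<rho>" by (rule AE_I2)
      show "?W \<in> borel_measurable M"
        by (rule measurable_from_subalg[OF F W_meas]) simp
    qed
    have "AE \<omega> in M. real_cond_exp M (F (Suc k)) ?L \<omega> \<le> real_cond_exp M (F (Suc k)) ?W \<omega>"
      by (rule F.real_cond_exp_mono) (use step[OF k] hi si W in auto)
    moreover have "AE \<omega> in M. real_cond_exp M (F (Suc k)) ?W \<omega> = ?W \<omega>"
      by (rule F.real_cond_exp_F_meas[OF W W_meas])
    moreover have "AE \<omega> in M. real_cond_exp M (F (Suc k)) ?L \<omega>
        = real_cond_exp M (F (Suc k)) (\<lambda>\<omega>. a k * h k \<omega>) \<omega>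
        - real_cond_exp M (F (Suc k)) (\<lambda>\<omega>. (a k)\<^sup>2 / (2 * \<sigma>) * s k \<omega>) \<omega>"
      by (rule F.real_cond_exp_diff) (use hi si in auto)
    moreover have "AE \<omega> in M. real_cond_exp M (F (Suc k)) (\<lambda>\<omega>. a k * h k \<omega>) \<omega> = a k * ?e k \<omega>"
      by (rule F.real_cond_exp_cmult[OF hi])
    moreover have "AE \<omega> in M. real_cond_exp M (F (Suc k)) (\<lambda>\<omega>. (a k)\<^sup>2 / (2 * \<sigma>) * s k \<omega>) \<omega>
        = (a k)\<^sup>2 / (2 * \<sigma>) * ?q k \<omega>"
      by (rule F.real_cond_exp_cmult[OF si])
    ultimately show "AE \<omega> in M. a k * ?e k \<omega> - (a k)\<^sup>2 / (2 * \<sigma>) * ?q k \<omega> \<le> Y k \<omega> - Y (Suc k) \<omega>"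
      by eventually_elim simp
  qed
  have Q: "integrable M Q"
    unfolding Q_def by (intro Bochner_Integration.integrable_sum integrable_mult_right q(1)) auto
  have "(\<integral>\<omega>. Q \<omega> \<partial>M) = (\<Sum>k=1..t. (a k)\<^sup>2 / (2 * \<sigma>) * (\<integral>\<omega>. ?q k \<omega> \<partial>M))"
    unfolding Q_def
    by (subst Bochner_Integration.integral_sum) (auto intro!: integrable_mult_right q(1))
  also have "\<dots> \<le> (\<Sum>k=1..t. (a k)\<^sup>2 / (2 * \<sigma>) * V)"
    using \<sigma> by (intro sum_mono mult_left_mono q(2)) auto
  finally have Q2: "(\<integral>\<omega>. Q \<omega> \<partial>M) \<le> V / (2 * \<sigma>) * (\<Sum>k=1..t. (a k)\<^sup>2)"
    by (simp add: sum_distrib_left mult.commute)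
  have "AE \<omega> in M. \<forall>k\<in>{1..t}. 0 \<le> ?q k \<omega>"
    by (subst AE_finite_all) (auto intro!: q(3))
  then have Q0: "AE \<omega> in M. 0 \<le> Q \<omega>"
    unfolding Q_def by eventually_elim (use \<sigma> in \<open>auto intro!: sum_nonneg mult_nonneg_nonneg\<close>)
  have "AE \<omega> in M. \<forall>k\<in>{1..t}. a k * ?e k \<omega> - (a k)\<^sup>2 / (2 * \<sigma>) * ?q k \<omega> \<le> Y k \<omega> - Y (Suc k) \<omega>"
    using descent by (subst AE_finite_all) auto
  with AE_space have main: "AE \<omega> in M. (\<Sum>k=1..t. a k * real_cond_exp M (F k) (h k) \<omega>) \<le> \<rho> + Q \<omega> + N \<omega>"
  proof eventually_elim
    case (elim \<omega>)
    have "(\<Sum>k=1..t. a k * real_cond_exp M (F k) (h k) \<omega>)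
        = (\<Sum>k=1..t. a k * ?e k \<omega> - (a k)\<^sup>2 / (2 * \<sigma>) * ?q k \<omega>) + Q \<omega> + N \<omega>"
      unfolding Q_def N_def d_def
      by (simp add: sum_subtractf right_diff_distrib)
    also have "(\<Sum>k=1..t. a k * ?e k \<omega> - (a k)\<^sup>2 / (2 * \<sigma>) * ?q k \<omega>) \<le> (\<Sum>k=1..t. Y k \<omega> - Y (Suc k) \<omega>)"
      using elim by (intro sum_mono) auto
    also have "(\<Sum>k=1..t. Y k \<omega> - Y (Suc k) \<omega>) = Y 1 \<omega> - Y (Suc t) \<omega>"
      by (induction t) auto
    also have "\<dots> \<le> \<rho>"
      using Y(2)[of 1 \<omega>] Y(2)[of "Suc t" \<omega>] elim by auto
    finally show ?case by simp
  qed
  show ?thesis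
    using main Q0 Q Q2 N_meas N(1) N2 by (intro exI[of _ Q] exI[of _ N] conjI)
qed

text \<open>With \<open>q = Q / c\<close> and \<open>n = N / c\<close> the event is \<open>2 / 3 \<le> q + n\<close>, where the inequality \<open>n - 1 / 4 \<le> n\<^sup>2\<close> gives
  \<open>5 / 12 = 2 / 3 - 1 / 4 \<le> q + n\<^sup>2\<close>. Markov's inequality for \<open>q + n\<^sup>2\<close>, whose mean is at most
  \<open>(1 / 6 + 2 / 9) * \<pi> = 7 / 18 * \<pi>\<close>, then yields the bound \<open>12 / 5 * 7 / 18 * \<pi> = 14 / 15 * \<pi>\<close>.
  The shift \<open>1 / 4\<close> comes from weighting \<open>q\<close> and \<open>n\<^sup>2\<close> equally, which is close enough to the best weights
  to stay below \<open>\<pi>\<close>.\<close>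

lemma combined_tail_bound:
  fixes Q N :: "'w \<Rightarrow> real"
  assumes P: "prob_space M" and c: "0 < c" and \<pi>: "0 \<le> \<pi>"
    and Q: "AE \<omega> in M. 0 \<le> Q \<omega>" "integrable M Q" "(\<integral>\<omega>. Q \<omega> \<partial>M) \<le> c * \<pi> / 6"
    and N: "N \<in> borel_measurable M" "integrable M (\<lambda>\<omega>. (N \<omega>)\<^sup>2)"
      "(\<integral>\<omega>. (N \<omega>)\<^sup>2 \<partial>M) \<le> 2 * c\<^sup>2 * \<pi> / 9"
  shows "measure M {\<omega>\<in>space M. 2 / 3 * c \<le> Q \<omega> + N \<omega>} \<le> \<pi>"
proof -
  interpret prob_space M by (rule P)
  note [measurable] = N(1) borel_measurable_integrable[OF Q(2)]
  let ?u = "\<lambda>\<omega>. Q \<omega> / c + (N \<omega>)\<^sup>2 / c\<^sup>2"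
  have u: "integrable M ?u" using Q(2) N(2) by simp
  have u0: "AE \<omega> in M. 0 \<le> ?u \<omega>"
    using Q(1) by eventually_elim (use c in auto)
  have "5 / 12 \<le> ?u \<omega>" if "2 / 3 * c \<le> Q \<omega> + N \<omega>" for \<omega>
  proof -
    have "2 / 3 \<le> Q \<omega> / c + N \<omega> / c" using that c by (simp add: field_simps)
    moreover have "N \<omega> / c - 1 / 4 \<le> (N \<omega> / c)\<^sup>2"
      using zero_le_power2[of "N \<omega> / c - 1 / 2"] by (simp add: power2_diff power_divide)
    ultimately show ?thesis unfolding power_divide by linarith
  qed
  then have "measure M {\<omega>\<in>space M. 2 / 3 * c \<le> Q \<omega> + N \<omega>} \<le> measure M {\<omega>\<in>space M. 5 / 12 \<le> ?u \<omega>}"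
    by (intro finite_measure_mono) auto
  also have "\<dots> \<le> (\<integral>\<omega>. ?u \<omega> \<partial>M) / (5 / 12)"
    by (rule integral_Markov_inequality_measure[OF u sets.empty_sets]) (use u0 in auto)
  also have "(\<integral>\<omega>. ?u \<omega> \<partial>M) = (\<integral>\<omega>. Q \<omega> \<partial>M) / c + (\<integral>\<omega>. (N \<omega>)\<^sup>2 \<partial>M) / c\<^sup>2"
    using Q(2) N(2) by simp
  also have "\<dots> \<le> (c * \<pi> / 6) / c + (2 * c\<^sup>2 * \<pi> / 9) / c\<^sup>2"
    using Q(3) N(3) c by (intro add_mono divide_right_mono) auto
  also have "\<dots> = 7 / 18 * \<pi>" using c by (simp add: field_simps)
  finally show ?thesis using \<pi> by simp
qed

section \<open>The accumulated step-size conditions\<close>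

lemma bias_factor_bounds:
  assumes \<sigma>: "0 < \<sigma>" and \<alpha>: "\<And>k. 1 \<le> k \<Longrightarrow> 0 < \<alpha> k" and B: "\<And>k. 1 \<le> k \<Longrightarrow> 0 \<le> B k"
    and S: "summable (\<lambda>k. \<alpha> (Suc k) * B (Suc k))"
  shows "bias_factor \<sigma> \<alpha> B = exp (2 / \<sigma> * (\<Sum>k. \<alpha> (Suc k) * B (Suc k)))"
    and "(\<Sum>k=1..t. \<alpha> k * B k) \<le> (\<Sum>k. \<alpha> (Suc k) * B (Suc k))"
    and "0 \<le> (\<Sum>k=1..t. \<alpha> k * B k)"
    and "1 + 2 / \<sigma> * (\<Sum>k=1..t. \<alpha> k * B k) \<le> bias_factor \<sigma> \<alpha> B"
proof -
  have pos: "0 \<le> \<alpha> k * B k" if "1 \<le> k" for k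
    using \<alpha>[OF that] B[OF that] by simp
  have "(\<lambda>k. 2 * \<alpha> (Suc k) * B (Suc k) / \<sigma>) = (\<lambda>k. 2 / \<sigma> * (\<alpha> (Suc k) * B (Suc k)))"
    by (rule ext) simp
  then show E: "bias_factor \<sigma> \<alpha> B = exp (2 / \<sigma> * (\<Sum>k. \<alpha> (Suc k) * B (Suc k)))"
    unfolding bias_factor_def by (simp only: suminf_mult[OF S])
  have "(\<Sum>k=1..t. \<alpha> k * B k) = (\<Sum>k<t. \<alpha> (Suc k) * B (Suc k))"
    by (rule sum.reindex_bij_witness[of _ Suc "\<lambda>k. k - 1"]) auto
  then show le: "(\<Sum>k=1..t. \<alpha> k * B k) \<le> (\<Sum>k. \<alpha> (Suc k) * B (Suc k))"
    using sum_le_suminf[OF S, of "{..<t}"] pos by simp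
  show "0 \<le> (\<Sum>k=1..t. \<alpha> k * B k)" using pos by (intro sum_nonneg) auto
  have "1 + 2 / \<sigma> * (\<Sum>k=1..t. \<alpha> k * B k) \<le> 1 + 2 / \<sigma> * (\<Sum>k. \<alpha> (Suc k) * B (Suc k))"
    using le \<sigma> by (simp add: divide_right_mono)
  also have "\<dots> \<le> bias_factor \<sigma> \<alpha> B" unfolding E by (rule exp_ge_add_one_self)
  finally show "1 + 2 / \<sigma> * (\<Sum>k=1..t. \<alpha> k * B k) \<le> bias_factor \<sigma> \<alpha> B" .
qed

text \<open>The thresholds are chosen before \<open>B\<close>, from the bound \<open>C\<close> alone. With \<open>C\<close> the actual sum of the
  series this gives thresholds along one sample path, and with an almost sure bound it gives
  deterministic ones. In the third condition \<open>\<Sum> (\<alpha> k * B k)\<^sup>2 \<le> C\<^sup>2\<close> since every single term of the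
  series is at most \<open>C\<close>, and the squared left-hand side dominates the sum itself once that
  exceeds \<open>1\<close>.\<close>

lemma thresholds_exist:
  assumes div: "filterlim (\<lambda>t. \<Sum>k=1..t. \<alpha> k) at_top sequentially"
    and sq: "summable (\<lambda>k. (\<alpha> (Suc k))\<^sup>2)"
    and step_pos: "\<forall>k\<ge>1. 0 < \<alpha> k"
    and pos: "0 < \<sigma>" "0 < \<epsilon>" "0 < p1" "0 \<le> \<kappa>\<^sub>1"
  shows "\<exists>t0\<ge>1. \<exists>t1\<ge>1. \<exists>t2\<ge>1. \<forall>B.
    (\<forall>k\<ge>1. 0 \<le> B k) \<longrightarrow> summable (\<lambda>k. \<alpha> (Suc k) * B (Suc k)) \<longrightarrow>
    (\<Sum>k. \<alpha> (Suc k) * B (Suc k)) \<le> C \<longrightarrow>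
      (\<forall>t\<ge>t0. condition_i \<epsilon> \<sigma> Rsup \<alpha> B t) \<and>
      (\<forall>t\<ge>t1. condition_ii \<epsilon> \<sigma> \<nu> p1 \<alpha> B t) \<and>
      (\<forall>t\<ge>t2. condition_iii \<epsilon> \<sigma> \<nu> G D \<kappa>\<^sub>1 \<alpha> B t)"
proof -
  note \<alpha> = step_pos[rule_format]
  define A2 where "A2 = (\<Sum>k. (\<alpha> (Suc k))\<^sup>2)"
  have A2: "(\<Sum>k=1..t. (\<alpha> k)\<^sup>2) \<le> A2" for t
  proof -
    have "(\<Sum>k=1..t. (\<alpha> k)\<^sup>2) = (\<Sum>k<t. (\<alpha> (Suc k))\<^sup>2)"
      by (rule sum.reindex_bij_witness[of _ Suc "\<lambda>k. k - 1"]) auto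
    then show ?thesis unfolding A2_def using sum_le_suminf[OF sq, of "{..<t}"] by simp
  qed
  define E where "E = exp (2 / \<sigma> * C)"
  define c0 where "c0 = 3 / \<epsilon> * E * (\<bar>Rsup\<bar> + C)"
  define c1 where "c1 = 3 * \<nu>\<^sup>2 / (\<sigma> * \<epsilon> * p1) * E * A2"
  define c2 where "c2 = 9 * D\<^sup>2 * \<kappa>\<^sub>1 / \<epsilon>\<^sup>2 * E * (A2 * (\<nu>\<^sup>2 + G\<^sup>2) + C * C)"
  have large: "\<exists>T\<ge>1. \<forall>t\<ge>T. c \<le> (\<Sum>k=1..t. \<alpha> k)" for c
  proof -
    obtain T where "\<forall>t\<ge>T. c \<le> (\<Sum>k=1..t. \<alpha> k)"
      using div unfolding filterlim_at_top eventually_sequentially by blast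
    then show ?thesis by (intro exI[of _ "max 1 T"]) auto
  qed
  obtain t0 where t0: "t0 \<ge> 1" "\<forall>t\<ge>t0. c0 \<le> (\<Sum>k=1..t. \<alpha> k)" using large by blast
  obtain t1 where t1: "t1 \<ge> 1" "\<forall>t\<ge>t1. c1 \<le> (\<Sum>k=1..t. \<alpha> k)" using large by blast
  obtain t2 where t2: "t2 \<ge> 1" "\<forall>t\<ge>t2. max 1 c2 \<le> (\<Sum>k=1..t. \<alpha> k)" using large by blast
  have "(\<forall>t\<ge>t0. condition_i \<epsilon> \<sigma> Rsup \<alpha> B t) \<and>
      (\<forall>t\<ge>t1. condition_ii \<epsilon> \<sigma> \<nu> p1 \<alpha> B t) \<and>
      (\<forall>t\<ge>t2. condition_iii \<epsilon> \<sigma> \<nu> G D \<kappa>\<^sub>1 \<alpha> B t)"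
    if B: "\<forall>k\<ge>1. 0 \<le> B k" and S: "summable (\<lambda>k. \<alpha> (Suc k) * B (Suc k))"
      and C: "(\<Sum>k. \<alpha> (Suc k) * B (Suc k)) \<le> C" for B
  proof -
    let ?W = "\<lambda>t. \<Sum>k=1..t. \<alpha> k * B k"
    have bf: "bias_factor \<sigma> \<alpha> B = exp (2 / \<sigma> * (\<Sum>k. \<alpha> (Suc k) * B (Suc k)))"
      "?W t \<le> (\<Sum>k. \<alpha> (Suc k) * B (Suc k))" "0 \<le> ?W t" for t
      by (rule bias_factor_bounds(1) bias_factor_bounds(2,3)[where \<sigma> = \<sigma>]; use pos \<alpha> B S in simp)+
    have WC: "?W t \<le> C" for t using bf(2)[of t] C by linarith
    have C0: "0 \<le> C" using bf(3)[of 0] WC[of 0] by simp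
    have E: "bias_factor \<sigma> \<alpha> B \<le> E"
      unfolding E_def bf(1) using C pos(1) by (simp add: divide_right_mono)
    have bf0: "0 \<le> bias_factor \<sigma> \<alpha> B" by (simp add: bias_factor_def)
    have i: "3 / \<epsilon> * bias_factor \<sigma> \<alpha> B * (Rsup + ?W t) \<le> c0" for t
    proof -
      have "3 / \<epsilon> * bias_factor \<sigma> \<alpha> B * (Rsup + ?W t) \<le> 3 / \<epsilon> * bias_factor \<sigma> \<alpha> B * (\<bar>Rsup\<bar> + C)"
        using bf0 pos(2) WC[of t] by (intro mult_left_mono add_mono) auto
      also have "\<dots> \<le> c0" unfolding c0_def
        using E pos(2) C0 by (intro mult_right_mono mult_left_mono) auto
      finally show ?thesis .
    qed
    have ii: "3 * \<nu>\<^sup>2 / (\<sigma> * \<epsilon> * p1) * bias_factor \<sigma> \<alpha> B * (\<Sum>k=1..t. (\<alpha> k)\<^sup>2) \<le> c1" for t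
      unfolding c1_def using E A2[of t] pos bf0
      by (intro mult_mono mult_left_mono mult_nonneg_nonneg sum_nonneg) (auto intro: order_trans[OF bf0])
    have sqs: "(\<Sum>k=1..t. (\<alpha> k)\<^sup>2 * (\<nu>\<^sup>2 + G\<^sup>2 + (B k)\<^sup>2)) \<le> A2 * (\<nu>\<^sup>2 + G\<^sup>2) + C * C" for t
    proof -
      have nn: "0 \<le> \<alpha> k * B k" if "1 \<le> k" for k
        using B \<alpha>[OF that] that by simp
      have one: "\<alpha> k * B k \<le> C" if "1 \<le> k" for k
      proof -
        have "\<alpha> k * B k \<le> ?W k"
          using nn that by (intro member_le_sum) auto
        then show ?thesis using WC[of k] by linarith
      qed
      have "(\<Sum>k=1..t. (\<alpha> k)\<^sup>2 * (\<nu>\<^sup>2 + G\<^sup>2 + (B k)\<^sup>2))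
          = (\<Sum>k=1..t. (\<alpha> k)\<^sup>2) * (\<nu>\<^sup>2 + G\<^sup>2) + (\<Sum>k=1..t. (\<alpha> k * B k) * (\<alpha> k * B k))"
        by (simp add: distrib_left sum.distrib sum_distrib_left power2_eq_square ac_simps)
      also have "(\<Sum>k=1..t. (\<alpha> k * B k) * (\<alpha> k * B k)) \<le> (\<Sum>k=1..t. C * (\<alpha> k * B k))"
        using one nn by (intro sum_mono mult_right_mono) auto
      also have "\<dots> = C * ?W t" by (simp add: sum_distrib_left)
      also have "\<dots> \<le> C * C" using WC[of t] C0 by (intro mult_left_mono)
      also have "(\<Sum>k=1..t. (\<alpha> k)\<^sup>2) * (\<nu>\<^sup>2 + G\<^sup>2) \<le> A2 * (\<nu>\<^sup>2 + G\<^sup>2)"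
        using A2 by (intro mult_right_mono) auto
      finally show ?thesis by simp
    qed
    have iii: "9 * D\<^sup>2 * \<kappa>\<^sub>1 / \<epsilon>\<^sup>2 * bias_factor \<sigma> \<alpha> B
        * (\<Sum>k=1..t. (\<alpha> k)\<^sup>2 * (\<nu>\<^sup>2 + G\<^sup>2 + (B k)\<^sup>2)) \<le> c2" for t
      unfolding c2_def using E sqs[of t] pos bf0
      by (intro mult_mono mult_left_mono mult_nonneg_nonneg sum_nonneg) (auto intro: order_trans[OF bf0])
    have "condition_iii \<epsilon> \<sigma> \<nu> G D \<kappa>\<^sub>1 \<alpha> B t" if "t \<ge> t2" for t
    proof -
      have "1 \<le> (\<Sum>k=1..t. \<alpha> k)" "c2 \<le> (\<Sum>k=1..t. \<alpha> k)" using t2(2) that by auto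
      then have "c2 \<le> (\<Sum>k=1..t. \<alpha> k)\<^sup>2"
        using self_le_power[of "\<Sum>k=1..t. \<alpha> k" 2] by linarith
      then show ?thesis unfolding condition_iii_def using iii[of t] by linarith
    qed
    moreover have "condition_i \<epsilon> \<sigma> Rsup \<alpha> B t" if "t \<ge> t0" for t
      unfolding condition_i_def using i[of t] t0(2) that order_trans by blast
    moreover have "condition_ii \<epsilon> \<sigma> \<nu> p1 \<alpha> B t" if "t \<ge> t1" for t
      unfolding condition_ii_def using ii[of t] t1(2) that order_trans by blast
    ultimately show ?thesis by blast
  qed
  then show ?thesis using t0(1) t1(1) t2(1) by blast
qed

text \<open>The effect of the bias is proportional to the distance between the iterate and the minimizer,
  which is at most \<open>r = sqrt (2 * \<rho> / \<sigma>)\<close>. From \<open>r \<le> (1 + r\<^sup>2) / 2 = 1 / 2 + \<rho> / \<sigma>\<close> the part proportional to \<open>\<rho>\<close> goes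
  into the exponential factor, through \<open>1 + u \<le> exp u\<close>, and the rest into the explicit sum.\<close>

lemma bias_absorption:
  assumes \<sigma>: "0 < \<sigma>" and \<epsilon>: "0 < \<epsilon>" and \<rho>: "0 \<le> \<rho>"
    and \<alpha>: "\<And>k. 1 \<le> k \<Longrightarrow> 0 < \<alpha> k" and B: "\<And>k. 1 \<le> k \<Longrightarrow> 0 \<le> B k"
    and S: "summable (\<lambda>k. \<alpha> (Suc k) * B (Suc k))"
    and i: "condition_i \<epsilon> \<sigma> \<rho> \<alpha> B t"
  shows "\<rho> + sqrt (2 * \<rho> / \<sigma>) * (\<Sum>k=1..t. \<alpha> k * B k) \<le> \<epsilon> * (\<Sum>k=1..t. \<alpha> k) / 3"
proof -
  let ?W = "\<Sum>k=1..t. \<alpha> k * B k" and ?E = "bias_factor \<sigma> \<alpha> B" and ?r = "sqrt (2 * \<rho> / \<sigma>)"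
  have W: "0 \<le> ?W" "1 + 2 / \<sigma> * ?W \<le> ?E"
    by (rule bias_factor_bounds(3)[where \<sigma> = \<sigma>] bias_factor_bounds(4); use \<sigma> \<alpha> B S in simp)+
  have W\<sigma>: "0 \<le> ?W / \<sigma>" "1 + 2 * (?W / \<sigma>) \<le> ?E" using W \<sigma> by simp_all
  then have E1: "1 \<le> ?E" by linarith
  have "0 \<le> (?r - 1)\<^sup>2" by simp
  then have "?r \<le> 1 / 2 + \<rho> / \<sigma>" using \<rho> \<sigma> by (simp add: power2_diff)
  then have "\<rho> + ?r * ?W \<le> \<rho> + (1 / 2 + \<rho> / \<sigma>) * ?W"
    using W(1) by (simp add: mult_right_mono)
  also have "\<dots> = \<rho> * (1 + ?W / \<sigma>) + ?W / 2" by (simp add: algebra_simps)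
  also have "\<dots> \<le> \<rho> * ?E + ?E * ?W"
  proof (intro add_mono mult_left_mono \<rho>)
    show "1 + ?W / \<sigma> \<le> ?E" using W\<sigma> by linarith
    show "?W / 2 \<le> ?E * ?W" using mult_right_mono[OF E1 W(1)] W(1) by linarith
  qed
  also have "\<dots> = ?E * (\<rho> + ?W)" by (simp add: algebra_simps)
  also have "\<dots> \<le> \<epsilon> * (\<Sum>k=1..t. \<alpha> k) / 3"
    using i \<epsilon> by (simp add: condition_i_def field_simps)
  finally show ?thesis .
qed

section \<open>Stochastic mirror descent\<close>

theorem corollary2:
  fixes M :: "'w measure"
    and nrm :: "real^'n \<Rightarrow> real"
    and X U :: "(real^'n) set"
    and f R :: "real^'n \<Rightarrow> real"
    and \<alpha> :: "nat \<Rightarrow> real"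
    and x gt g b :: "nat \<Rightarrow> 'w \<Rightarrow> real^'n"
    and B :: "nat \<Rightarrow> 'w \<Rightarrow> real"
    and z :: "nat \<Rightarrow> 'w \<Rightarrow> real^'n"
    and G D \<sigma> \<nu> \<kappa>\<^sub>1 \<epsilon> p p1 Rsup fstar :: real
  assumes prob: "prob_space M"
    and nrm: "is_norm nrm"
    and X: "convex X" "compact X" "X \<noteq> {}"
    and D: "D = norm_diameter nrm X"
    and f: "convex_on UNIV f" "continuous_on UNIV f"
    and fstar: "fstar = (INF y\<in>X. f y)"
    and G: "0 < G"
      "\<And>y h. y \<in> X \<Longrightarrow> h \<in> subdifferential f y \<Longrightarrow> dual_norm nrm h \<le> G"
    and R: "open U" "X \<subseteq> U" "strongly_convex_on nrm U \<sigma> R" "R differentiable_on U"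
    and Rsup: "Rsup = (SUP (y, w)\<in>X \<times> X. bregman R y w)"
    and kappa: "0 < \<kappa>\<^sub>1"
      "\<And>u v w. (dual_norm nrm (u + v + w))\<^sup>2
         \<le> \<kappa>\<^sub>1 * ((dual_norm nrm u)\<^sup>2 + (dual_norm nrm v)\<^sup>2 + (dual_norm nrm w)\<^sup>2)"
    and alpha: "\<And>t. 1 \<le> t \<Longrightarrow> 0 < \<alpha> t"
    and random_vectors: "\<And>t. 1 \<le> t \<Longrightarrow> x t \<in> borel_measurable M"
      "\<And>t. 1 \<le> t \<Longrightarrow> gt t \<in> borel_measurable M"
    and start: "\<And>\<omega>. \<omega> \<in> space M \<Longrightarrow> x 1 \<omega> \<in> X"
    and algorithm: "\<And>t \<omega>. 1 \<le> t \<Longrightarrow> \<omega> \<in> space M \<Longrightarrow>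
      is_arg_min (\<lambda>y. gt t \<omega> \<bullet> (y - x t \<omega>) + 1 / \<alpha> t * bregman R y (x t \<omega>))
        (\<lambda>y. y \<in> X) (x (Suc t) \<omega>)"
    and subgradient: "\<And>t. 1 \<le> t \<Longrightarrow> AE \<omega> in M. g t \<omega> \<in> subdifferential f (x t \<omega>)"
    and bias: "\<And>t. 1 \<le> t \<Longrightarrow> b t \<in> borel_measurable (history M x t)"
    and A1_mean: "\<And>t. 1 \<le> t \<Longrightarrow>
      AE \<omega> in M. vector_cond_exp M (history M x t) (gt t) \<omega> = g t \<omega> + b t \<omega>"
    and A1_second_moment: "\<And>t. 1 \<le> t \<Longrightarrow>
      AE \<omega> in M. nn_cond_exp M (history M x t) (\<lambda>\<omega>'. ennreal ((dual_norm nrm (gt t \<omega>'))\<^sup>2)) \<omega>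
        \<le> ennreal (\<nu>\<^sup>2)"
    and A2: "filterlim (\<lambda>t. \<Sum>k=1..t. \<alpha> k) at_top sequentially"
      "summable (\<lambda>k. (\<alpha> (Suc k))\<^sup>2)"
    and B: "B = (\<lambda>t \<omega>. dual_norm nrm (b t \<omega>))"
    and A3: "AE \<omega> in M. summable (\<lambda>k. \<alpha> (Suc k) * B (Suc k) \<omega>)"
    and z: "z = (\<lambda>t \<omega>. weighted_average \<alpha> (\<lambda>j. x j \<omega>) t)"
    and eps: "0 < \<epsilon>"
    and p: "0 < p" "p < 1" "p1 = 1 - p"
  shows
    "(\<forall>t0\<ge>1. \<forall>t1\<ge>1. \<forall>t2\<ge>1.
        (AE \<omega> in M. \<forall>t\<ge>t0. condition_i \<epsilon> \<sigma> Rsup \<alpha> (\<lambda>k. B k \<omega>) t) \<and>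
        (AE \<omega> in M. \<forall>t\<ge>t1. condition_ii \<epsilon> \<sigma> \<nu> p1 \<alpha> (\<lambda>k. B k \<omega>) t) \<and>
        (AE \<omega> in M. \<forall>t\<ge>t2. condition_iii \<epsilon> \<sigma> \<nu> G D \<kappa>\<^sub>1 \<alpha> (\<lambda>k. B k \<omega>) t) \<longrightarrow>
        (\<forall>t\<ge>Max {t0, t1, t2}. measure M {\<omega> \<in> space M. f (z t \<omega>) - fstar < \<epsilon>} \<ge> p))
     \<and>
     (AE \<omega> in M. \<exists>t0\<ge>1. \<exists>t1\<ge>1. \<exists>t2\<ge>1.
        (\<forall>t\<ge>t0. condition_i \<epsilon> \<sigma> Rsup \<alpha> (\<lambda>k. B k \<omega>) t) \<and>
        (\<forall>t\<ge>t1. condition_ii \<epsilon> \<sigma> \<nu> p1 \<alpha> (\<lambda>k. B k \<omega>) t) \<and>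
        (\<forall>t\<ge>t2. condition_iii \<epsilon> \<sigma> \<nu> G D \<kappa>\<^sub>1 \<alpha> (\<lambda>k. B k \<omega>) t))
     \<and>
     ((\<exists>C. AE \<omega> in M. (\<Sum>k. \<alpha> (Suc k) * B (Suc k) \<omega>) \<le> C) \<longrightarrow>
      (\<exists>t0\<ge>1. \<exists>t1\<ge>1. \<exists>t2\<ge>1.
        (AE \<omega> in M. \<forall>t\<ge>t0. condition_i \<epsilon> \<sigma> Rsup \<alpha> (\<lambda>k. B k \<omega>) t) \<and>
        (AE \<omega> in M. \<forall>t\<ge>t1. condition_ii \<epsilon> \<sigma> \<nu> p1 \<alpha> (\<lambda>k. B k \<omega>) t) \<and>
        (AE \<omega> in M. \<forall>t\<ge>t2. condition_iii \<epsilon> \<sigma> \<nu> G D \<kappa>\<^sub>1 \<alpha> (\<lambda>k. B k \<omega>) t)))"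
proof -
  interpret prob_space M by (rule prob)
  have \<sigma>: "0 < \<sigma>" using R(3) by (simp add: strongly_convex_on_def)
  have p1: "0 < p1" using p by simp
  have B0: "0 \<le> B k \<omega>" for k \<omega> unfolding B by (rule dual_norm_nonneg[OF nrm])
  have in_X: "x k \<omega> \<in> X" if "1 \<le> k" "\<omega> \<in> space M" for k \<omega>
  proof (cases "k = 1")
    case False
    with that have "1 \<le> k - 1" "Suc (k - 1) = k" by auto
    with algorithm[of "k - 1" \<omega>] that show ?thesis by (simp add: is_arg_min_def)
  qed (use start that in simp)

  note breg = bregman_lower_bound[OF R(1) R(4) R(3)]
  have breg_bdd: "bdd_above ((\<lambda>(y, w). bregman R y w) ` (X \<times> X))"
    by (rule bregman_bdd_above[OF R(1) R(4) R(3) X(2) R(2)])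
  have breg_le: "bregman R y w \<le> Rsup" if "y \<in> X" "w \<in> X" for y w
    unfolding Rsup using cSUP_upper[OF _ breg_bdd, of "(y, w)"] that by simp
  have breg_0: "0 \<le> bregman R y w" if "y \<in> X" "w \<in> X" for y w
    using bregman_nonneg[OF R(1) R(4) R(3)] R(2) that by blast
  have Rsup0: "0 \<le> Rsup"
    using X(3) breg_0 breg_le order_trans by blast
  \<comment> \<open>This radius plays the role of the diameter: strong convexity bounds distances in \<open>X\<close> by
    divergences, so that later noise and bias are measured against \<open>Rsup\<close>.\<close>
  define r where "r = sqrt (2 * Rsup / \<sigma>)"
  have r0: "0 \<le> r" and r2: "r\<^sup>2 = 2 * Rsup / \<sigma>" using Rsup0 \<sigma> by (auto simp: r_def)
  have dist_le: "nrm (y - w) \<le> r" if "y \<in> X" "w \<in> X" for y w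
  proof -
    have "\<sigma> / 2 * (nrm (y - w))\<^sup>2 \<le> Rsup"
      using breg[of y w] breg_le[OF that] R(2) that by force
    then have "(nrm (y - w))\<^sup>2 \<le> 2 * Rsup / \<sigma>" using \<sigma> by (simp add: field_simps)
    then show ?thesis unfolding r_def by (rule real_le_rsqrt)
  qed

  obtain y where y: "y \<in> X" "\<forall>w\<in>X. f y \<le> f w"
    by (metis continuous_attains_inf[OF X(2,3)] continuous_on_subset[OF f(2) subset_UNIV])
  have fy: "fstar = f y"
    unfolding fstar using y by (intro cInf_eq_minimum) auto

  define H where "H = history M x"
  have H: "subalgebra M (H k)" for k
    unfolding H_def by (rule history_subalgebra) (use random_vectors(1) in auto)
  have H_mono: "subalgebra (H k) (H j)" if "j \<le> k" for j k
    unfolding H_def by (rule history_mono[OF that])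
  have x_H: "x k \<in> borel_measurable (H k)" if "1 \<le> k" for k
    unfolding H_def by (rule history_measurable) (use that in auto)

  define s where "s = (\<lambda>k \<omega>. (dual_norm nrm (gt k \<omega>))\<^sup>2)"
  define h where "h = (\<lambda>k \<omega>. gt k \<omega> \<bullet> (x k \<omega> - y))"
  have s0: "0 \<le> s k \<omega>" for k \<omega> by (simp add: s_def)
  have s_meas: "s k \<in> borel_measurable M" if "1 \<le> k" for k
    unfolding s_def
    using measurable_compose[OF random_vectors(2)[OF that] dual_norm_measurable[OF nrm]] by simp
  have s: "integrable M (s k)" "(\<integral>\<omega>. s k \<omega> \<partial>M) \<le> \<nu>\<^sup>2" if k: "1 \<le> k" for k
  proof -
    interpret F: finite_measure_subalgebra M "H k" by unfold_locales (rule H)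
    note [measurable] = s_meas[OF k]
    have "(\<integral>\<^sup>+\<omega>. ennreal (s k \<omega>) \<partial>M) = (\<integral>\<^sup>+\<omega>. nn_cond_exp M (H k) (\<lambda>\<omega>. ennreal (s k \<omega>)) \<omega> \<partial>M)"
      using F.nn_cond_exp_intg[of "\<lambda>_. 1" "\<lambda>\<omega>. ennreal (s k \<omega>)"] by simp
    also have "\<dots> \<le> (\<integral>\<^sup>+\<omega>. ennreal (\<nu>\<^sup>2) \<partial>M)"
      using A1_second_moment[OF k] unfolding s_def H_def by (rule nn_integral_mono_AE)
    also have "\<dots> = ennreal (\<nu>\<^sup>2)" by (simp add: emeasure_space_1)
    finally have le: "(\<integral>\<^sup>+\<omega>. ennreal (s k \<omega>) \<partial>M) \<le> ennreal (\<nu>\<^sup>2)" .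
    show "integrable M (s k)"
      using le s0 by (intro integrableI_nonneg) (auto simp: le_less_trans[OF _ ennreal_less_top])
    show "(\<integral>\<omega>. s k \<omega> \<partial>M) \<le> \<nu>\<^sup>2"
      using integral_real_bounded[OF _ le] by simp
  qed
  have gt_int: "integrable M (\<lambda>\<omega>. gt k \<omega> \<bullet> i)" if k: "1 \<le> k" for k i
  proof (rule Bochner_Integration.integrable_bound)
    show "integrable M (\<lambda>\<omega>. (s k \<omega> + 1) * nrm i)" using s(1)[OF k] by simp
    show "(\<lambda>\<omega>. gt k \<omega> \<bullet> i) \<in> borel_measurable M"
      using random_vectors(2)[OF k] by simp
    show "AE \<omega> in M. norm (gt k \<omega> \<bullet> i) \<le> norm ((s k \<omega> + 1) * nrm i)"
    proof (rule AE_I2)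
      fix \<omega>
      let ?d = "dual_norm nrm (gt k \<omega>)"
      have "2 * ?d \<le> ?d\<^sup>2 + 1" using sum_squares_bound[of ?d 1] by simp
      then have "?d \<le> s k \<omega> + 1" using dual_norm_nonneg[OF nrm, of "gt k \<omega>"] unfolding s_def by linarith
      then have "?d * nrm i \<le> (s k \<omega> + 1) * nrm i" by (rule mult_right_mono) (rule is_normD(1)[OF nrm])
      then show "norm (gt k \<omega> \<bullet> i) \<le> norm ((s k \<omega> + 1) * nrm i)"
        using abs_inner_le_dual_norm[OF nrm, of "gt k \<omega>" i] by simp
    qed
  qed
  have h_meas: "h k \<in> borel_measurable M" if "1 \<le> k" for k
    unfolding h_def using random_vectors[OF that] by simp
  have hs: "(h k \<omega>)\<^sup>2 \<le> r\<^sup>2 * s k \<omega>" if "1 \<le> k" "\<omega> \<in> space M" for k \<omega>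
  proof -
    have "\<bar>h k \<omega>\<bar> \<le> dual_norm nrm (gt k \<omega>) * nrm (x k \<omega> - y)"
      unfolding h_def by (rule abs_inner_le_dual_norm[OF nrm])
    also have "\<dots> \<le> dual_norm nrm (gt k \<omega>) * r"
      using dist_le[OF in_X[OF that] y(1)] dual_norm_nonneg[OF nrm] by (rule mult_left_mono)
    finally have "\<bar>h k \<omega>\<bar>\<^sup>2 \<le> (dual_norm nrm (gt k \<omega>) * r)\<^sup>2" by (intro power_mono) auto
    then show ?thesis by (simp add: s_def power_mult_distrib mult.commute)
  qed
  obtain K where K: "\<forall>w\<in>X. norm w \<le> K"
    using compact_imp_bounded[OF X(2)] unfolding bounded_iff by (elim exE)
  have cond_h: "AE \<omega> in M. real_cond_exp M (H k) (h k) \<omega> = (g k \<omega> + b k \<omega>) \<bullet> (x k \<omega> - y)"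
    if k: "1 \<le> k" for k
  proof -
    have "AE \<omega> in M. real_cond_exp M (H k) (h k) \<omega>
        = vector_cond_exp M (H k) (gt k) \<omega> \<bullet> (x k \<omega> - y)"
      unfolding h_def
    proof (rule real_cond_exp_inner[OF prob H random_vectors(2)[OF k] gt_int[OF k]])
      show "(\<lambda>\<omega>. x k \<omega> - y) \<in> borel_measurable (H k)" using x_H[OF k] by simp
      show "norm (x k \<omega> - y) \<le> K + K" if "\<omega> \<in> space M" for \<omega>
        using norm_triangle_ineq4[of "x k \<omega>" y] K[rule_format, OF in_X[OF k that]] K[rule_format, OF y(1)]
        by linarith
    qed
    moreover note A1_mean[OF k, folded H_def]
    ultimately show ?thesis by eventually_elim simp
  qed

  define Y where "Y = (\<lambda>k \<omega>. bregman R y (x k \<omega>))"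
  have Y_meas: "Y k \<in> borel_measurable (H k)" if k: "1 \<le> k" for k
    unfolding Y_def
  proof (rule bregman_measurable[OF R(1) R(4) x_H[OF k]])
    fix \<omega> assume "\<omega> \<in> space (H k)"
    then show "x k \<omega> \<in> U" using in_X[OF k] R(2) by (auto simp: H_def history_space)
  qed
  have Y_bounds: "0 \<le> Y k \<omega> \<and> Y k \<omega> \<le> Rsup" if "1 \<le> k" "\<omega> \<in> space M" for k \<omega>
    unfolding Y_def using breg_0 breg_le y(1) in_X[OF that] by blast
  have step: "\<alpha> k * h k \<omega> - (\<alpha> k)\<^sup>2 / (2 * \<sigma>) * s k \<omega> \<le> Y k \<omega> - Y (Suc k) \<omega>"
    if "1 \<le> k" "\<omega> \<in> space M" for k \<omega>
    unfolding h_def s_def Y_def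
    by (rule mirror_step_descent[OF nrm R(1) R(4) R(3) X(1) R(2) alpha[OF that(1)] in_X[OF that]
          algorithm[OF that] y(1)])

  have tail: "p \<le> measure M {\<omega> \<in> space M. f (z t \<omega>) - fstar < \<epsilon>}"
    if t: "1 \<le> t"
      and i: "AE \<omega> in M. condition_i \<epsilon> \<sigma> Rsup \<alpha> (\<lambda>k. B k \<omega>) t"
      and ii: "AE \<omega> in M. condition_ii \<epsilon> \<sigma> \<nu> p1 \<alpha> (\<lambda>k. B k \<omega>) t" for t
  proof -
    let ?S = "\<Sum>k=1..t. \<alpha> k" and ?S2 = "\<Sum>k=1..t. (\<alpha> k)\<^sup>2"
    have S: "0 < ?S" using t alpha by (intro sum_pos) auto
    define c where "c = \<epsilon> * ?S"
    have c: "0 < c" using S eps by (simp add: c_def)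
    have S2: "0 \<le> ?S2" by (intro sum_nonneg) simp
    have absorbed: "AE \<omega> in M. Rsup + r * (\<Sum>k=1..t. \<alpha> k * B k \<omega>) \<le> c / 3"
      using i A3
    proof eventually_elim
      case (elim \<omega>)
      show ?case
        unfolding r_def c_def
        by (rule bias_absorption[OF \<sigma> eps Rsup0 alpha B0 elim(2) elim(1)])
    qed
    \<comment> \<open>Both inequalities compare constants and are reached through conditions that hold only almost
      surely, where the random bias terms can be dropped; since the space has positive mass, an
      almost sure statement about constants is true.\<close>
    have "AE \<omega> in M. Rsup \<le> c / 3 \<and> 3 * \<nu>\<^sup>2 * ?S2 \<le> \<sigma> * c * p1"
      using absorbed ii A3
    proof eventually_elim
      case (elim \<omega>)
      let ?E = "bias_factor \<sigma> \<alpha> (\<lambda>k. B k \<omega>)" and ?W = "\<Sum>k=1..t. \<alpha> k * B k \<omega>"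
      have W: "0 \<le> ?W" "1 + 2 / \<sigma> * ?W \<le> ?E"
        by (rule bias_factor_bounds(3)[where \<sigma> = \<sigma>] bias_factor_bounds(4);
            use \<sigma> alpha B0 elim(3) in simp)+
      have "0 \<le> 2 / \<sigma> * ?W" using W(1) \<sigma> by simp
      then have "1 \<le> ?E" using W(2) by linarith
      then have "3 * \<nu>\<^sup>2 / (\<sigma> * \<epsilon> * p1) * 1 * ?S2 \<le> 3 * \<nu>\<^sup>2 / (\<sigma> * \<epsilon> * p1) * ?E * ?S2"
        using \<sigma> eps p1 S2 by (intro mult_right_mono mult_left_mono) auto
      also have "\<dots> \<le> ?S" using elim(2) unfolding condition_ii_def .
      finally have "3 * \<nu>\<^sup>2 * ?S2 \<le> \<sigma> * c * p1"
        using \<sigma> eps p1 by (simp add: c_def field_simps)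
      moreover have "0 \<le> r * ?W" using r0 W(1) by simp
      ultimately show ?case using elim(1) by linarith
    qed
    then have Rc: "Rsup \<le> c / 3" and Vc: "3 * \<nu>\<^sup>2 * ?S2 \<le> \<sigma> * c * p1" by auto

    obtain Q N where descent: "AE \<omega> in M. (\<Sum>k=1..t. \<alpha> k * real_cond_exp M (H k) (h k) \<omega>) \<le> Rsup + Q \<omega> + N \<omega>"
      and Q: "AE \<omega> in M. 0 \<le> Q \<omega>" "integrable M Q" "(\<integral>\<omega>. Q \<omega> \<partial>M) \<le> \<nu>\<^sup>2 / (2 * \<sigma>) * ?S2"
      and N: "N \<in> borel_measurable M" "integrable M (\<lambda>\<omega>. (N \<omega>)\<^sup>2)"
        "(\<integral>\<omega>. (N \<omega>)\<^sup>2 \<partial>M) \<le> r\<^sup>2 * \<nu>\<^sup>2 * ?S2"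
      using conditioned_descent[of M H Y Rsup h s "\<nu>\<^sup>2" "r\<^sup>2" \<sigma> \<alpha> t, OF prob H H_mono Y_meas Y_bounds
          h_meas s s0 hs zero_le_power2 \<sigma> step] by blast
    \<comment> \<open>One factor \<open>c\<close> of the noise bound comes from condition (i), through the radius, and the other
      one, together with \<open>p1\<close>, from condition (ii).\<close>
    have "\<nu>\<^sup>2 / (2 * \<sigma>) * ?S2 \<le> c * p1 / 6" using Vc \<sigma> by (simp add: field_simps)
    with Q(3) have Q3: "(\<integral>\<omega>. Q \<omega> \<partial>M) \<le> c * p1 / 6" by linarith
    have "r\<^sup>2 * \<nu>\<^sup>2 * ?S2 = 2 * Rsup / \<sigma> * (\<nu>\<^sup>2 * ?S2)" by (simp add: r2)
    also have "\<dots> \<le> 2 * Rsup / \<sigma> * (\<sigma> * c * p1 / 3)"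
      using Vc Rsup0 \<sigma> by (intro mult_left_mono) auto
    also have "\<dots> = 2 * Rsup * (c * p1 / 3)" using \<sigma> by simp
    also have "\<dots> \<le> 2 * (c / 3) * (c * p1 / 3)"
      using Rc c p1 by (intro mult_right_mono mult_left_mono) auto
    also have "\<dots> = 2 * c\<^sup>2 * p1 / 9" by (simp add: power2_eq_square)
    finally have N3: "(\<integral>\<omega>. (N \<omega>)\<^sup>2 \<partial>M) \<le> 2 * c\<^sup>2 * p1 / 9" using N(3) by linarith
    let ?bad = "{\<omega> \<in> space M. 2 / 3 * c \<le> Q \<omega> + N \<omega>}"
    have bad: "measure M ?bad \<le> p1"
      by (rule combined_tail_bound[OF prob c less_imp_le[OF p1] Q(1,2) Q3 N(1,2) N3])
    have bad_meas: "?bad \<in> sets M"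
      using N(1) borel_measurable_integrable[OF Q(2)] by measurable

    have "AE \<omega> in M. \<forall>k\<in>{1..t}. g k \<omega> \<in> subdifferential f (x k \<omega>)"
      using subgradient by (subst AE_finite_all) auto
    moreover have "AE \<omega> in M. \<forall>k\<in>{1..t}.
        real_cond_exp M (H k) (h k) \<omega> = (g k \<omega> + b k \<omega>) \<bullet> (x k \<omega> - y)"
      using cond_h by (subst AE_finite_all) auto
    ultimately have gap: "AE \<omega> in M. \<omega> \<notin> ?bad \<longrightarrow> f (z t \<omega>) - fstar < \<epsilon>"
      using descent absorbed AE_space
    proof eventually_elim
      case (elim \<omega>)
      let ?e = "\<lambda>k. real_cond_exp M (H k) (h k) \<omega>"
      have one: "f (x k \<omega>) - fstar \<le> ?e k + r * B k \<omega>" if k: "k \<in> {1..t}" for k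
      proof -
        have "f (x k \<omega>) + g k \<omega> \<bullet> (y - x k \<omega>) \<le> f y"
          using elim(1) k by (auto simp: subdifferential_def)
        then have "f (x k \<omega>) - fstar \<le> g k \<omega> \<bullet> (x k \<omega> - y)"
          by (simp add: fy inner_diff_right)
        also have "\<dots> = ?e k + b k \<omega> \<bullet> (y - x k \<omega>)"
          using elim(2) k by (simp add: inner_simps)
        also have "b k \<omega> \<bullet> (y - x k \<omega>) \<le> B k \<omega> * nrm (y - x k \<omega>)"
          unfolding B by (rule inner_le_dual_norm[OF nrm])
        also have "\<dots> \<le> B k \<omega> * r"
          using k elim(5) by (intro mult_left_mono dist_le y(1) in_X B0) auto
        finally show ?thesis by (simp add: mult.commute)
      qed
      have "z t \<omega> = (\<Sum>k=1..t. (\<alpha> k / ?S) *\<^sub>R x k \<omega>)"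
        by (simp add: z weighted_average_def scaleR_sum_right divide_inverse mult.commute)
      moreover have "f (\<Sum>k=1..t. (\<alpha> k / ?S) *\<^sub>R x k \<omega>) \<le> (\<Sum>k=1..t. \<alpha> k / ?S * f (x k \<omega>))"
      proof (rule convex_on_sum[OF _ _ f(1)])
        show "(\<Sum>k=1..t. \<alpha> k / ?S) = 1" using S by (simp add: sum_divide_distrib[symmetric])
      qed (use t alpha S in \<open>auto intro!: divide_nonneg_pos less_imp_le\<close>)
      ultimately have "f (z t \<omega>) \<le> (\<Sum>k=1..t. \<alpha> k * f (x k \<omega>)) / ?S"
        by (simp add: sum_divide_distrib)
      then have "?S * (f (z t \<omega>) - fstar) \<le> (\<Sum>k=1..t. \<alpha> k * f (x k \<omega>)) - ?S * fstar"
        using S by (simp add: field_simps)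
      also have "\<dots> = (\<Sum>k=1..t. \<alpha> k * (f (x k \<omega>) - fstar))"
        by (simp add: right_diff_distrib sum_subtractf sum_distrib_right)
      also have "\<dots> \<le> (\<Sum>k=1..t. \<alpha> k * (?e k + r * B k \<omega>))"
        using one alpha by (intro sum_mono mult_left_mono) (auto intro: less_imp_le)
      also have "\<dots> = (\<Sum>k=1..t. \<alpha> k * ?e k) + r * (\<Sum>k=1..t. \<alpha> k * B k \<omega>)"
        by (simp add: distrib_left sum.distrib sum_distrib_left mult.left_commute)
      also have "\<dots> \<le> Q \<omega> + N \<omega> + c / 3" using elim(3,4) by linarith
      finally have "?S * (f (z t \<omega>) - fstar) \<le> Q \<omega> + N \<omega> + c / 3" .
      moreover have "Q \<omega> + N \<omega> < 2 / 3 * c" if "\<omega> \<notin> ?bad" using that elim(5) by auto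
      ultimately have "?S * (f (z t \<omega>) - fstar) < ?S * \<epsilon>" if "\<omega> \<notin> ?bad"
        using that by (fastforce simp: c_def mult.commute)
      then show ?case using S by simp
    qed
    have f_meas: "f \<in> borel_measurable borel" by (rule borel_measurable_continuous_onI[OF f(2)])
    have "z t \<in> borel_measurable M"
      unfolding z weighted_average_def
      by (intro borel_measurable_scaleR borel_measurable_const borel_measurable_sum random_vectors(1)) auto
    then have good_meas: "{\<omega> \<in> space M. f (z t \<omega>) - fstar < \<epsilon>} \<in> sets M"
      using f_meas by measurable
    have "p \<le> 1 - measure M ?bad" using bad p by simp
    also have "\<dots> = measure M (space M - ?bad)" by (rule prob_compl[OF bad_meas, symmetric])
    also have "\<dots> \<le> measure M {\<omega> \<in> space M. f (z t \<omega>) - fstar < \<epsilon>}"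
    proof (rule finite_measure_mono_AE[OF _ good_meas])
      show "AE \<omega> in M. \<omega> \<in> space M - ?bad \<longrightarrow> \<omega> \<in> {\<omega> \<in> space M. f (z t \<omega>) - fstar < \<epsilon>}"
        using gap by eventually_elim auto
    qed
    finally show ?thesis .
  qed

  have "\<forall>k\<ge>1. 0 < \<alpha> k" using alpha by simp
  note thresholds = thresholds_exist[OF A2 this \<sigma> eps p1 less_imp_le[OF kappa(1)],
      where \<nu> = \<nu> and G = G and D = D and Rsup = Rsup]
  show ?thesis
  proof (intro conjI allI impI)
    fix t0 t1 t2 t :: nat
    assume "1 \<le> t0" "1 \<le> t1" "1 \<le> t2" and t: "Max {t0, t1, t2} \<le> t"
      and conds: "(AE \<omega> in M. \<forall>t\<ge>t0. condition_i \<epsilon> \<sigma> Rsup \<alpha> (\<lambda>k. B k \<omega>) t) \<and>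
        (AE \<omega> in M. \<forall>t\<ge>t1. condition_ii \<epsilon> \<sigma> \<nu> p1 \<alpha> (\<lambda>k. B k \<omega>) t) \<and>
        (AE \<omega> in M. \<forall>t\<ge>t2. condition_iii \<epsilon> \<sigma> \<nu> G D \<kappa>\<^sub>1 \<alpha> (\<lambda>k. B k \<omega>) t)"
    have "1 \<le> t" "t0 \<le> t" "t1 \<le> t" using t \<open>1 \<le> t0\<close> by auto
    show "p \<le> measure M {\<omega> \<in> space M. f (z t \<omega>) - fstar < \<epsilon>}"
    proof (rule tail[OF \<open>1 \<le> t\<close>])
      show "AE \<omega> in M. condition_i \<epsilon> \<sigma> Rsup \<alpha> (\<lambda>k. B k \<omega>) t"
        using conds[THEN conjunct1] by eventually_elim (use \<open>t0 \<le> t\<close> in simp)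
      show "AE \<omega> in M. condition_ii \<epsilon> \<sigma> \<nu> p1 \<alpha> (\<lambda>k. B k \<omega>) t"
        using conds[THEN conjunct2, THEN conjunct1] by eventually_elim (use \<open>t1 \<le> t\<close> in simp)
    qed
  next
    show "AE \<omega> in M. \<exists>t0\<ge>1. \<exists>t1\<ge>1. \<exists>t2\<ge>1.
        (\<forall>t\<ge>t0. condition_i \<epsilon> \<sigma> Rsup \<alpha> (\<lambda>k. B k \<omega>) t) \<and>
        (\<forall>t\<ge>t1. condition_ii \<epsilon> \<sigma> \<nu> p1 \<alpha> (\<lambda>k. B k \<omega>) t) \<and>
        (\<forall>t\<ge>t2. condition_iii \<epsilon> \<sigma> \<nu> G D \<kappa>\<^sub>1 \<alpha> (\<lambda>k. B k \<omega>) t)"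
      using A3
    proof eventually_elim
      case (elim \<omega>)
      obtain t0 t1 t2 where t: "1 \<le> t0" "1 \<le> t1" "1 \<le> t2"
        and all: "\<forall>B'. (\<forall>k\<ge>1. 0 \<le> B' k) \<longrightarrow> summable (\<lambda>k. \<alpha> (Suc k) * B' (Suc k)) \<longrightarrow>
          (\<Sum>k. \<alpha> (Suc k) * B' (Suc k)) \<le> (\<Sum>k. \<alpha> (Suc k) * B (Suc k) \<omega>) \<longrightarrow>
            (\<forall>t\<ge>t0. condition_i \<epsilon> \<sigma> Rsup \<alpha> B' t) \<and>
            (\<forall>t\<ge>t1. condition_ii \<epsilon> \<sigma> \<nu> p1 \<alpha> B' t) \<and>
            (\<forall>t\<ge>t2. condition_iii \<epsilon> \<sigma> \<nu> G D \<kappa>\<^sub>1 \<alpha> B' t)"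
        using thresholds[where C = "\<Sum>k. \<alpha> (Suc k) * B (Suc k) \<omega>"] by (elim exE conjE)
      have "(\<forall>t\<ge>t0. condition_i \<epsilon> \<sigma> Rsup \<alpha> (\<lambda>k. B k \<omega>) t) \<and>
          (\<forall>t\<ge>t1. condition_ii \<epsilon> \<sigma> \<nu> p1 \<alpha> (\<lambda>k. B k \<omega>) t) \<and>
          (\<forall>t\<ge>t2. condition_iii \<epsilon> \<sigma> \<nu> G D \<kappa>\<^sub>1 \<alpha> (\<lambda>k. B k \<omega>) t)"
        using all[THEN spec, of "\<lambda>k. B k \<omega>"] elim B0 by simp
      with t show ?case by (intro exI[of _ t0] exI[of _ t1] exI[of _ t2] conjI) simp_all
    qed
  next
    assume "\<exists>C. AE \<omega> in M. (\<Sum>k. \<alpha> (Suc k) * B (Suc k) \<omega>) \<le> C"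
    then obtain C where C: "AE \<omega> in M. (\<Sum>k. \<alpha> (Suc k) * B (Suc k) \<omega>) \<le> C" by (elim exE)
    obtain t0 t1 t2 where t: "1 \<le> t0" "1 \<le> t1" "1 \<le> t2"
      and all: "\<forall>B. (\<forall>k\<ge>1. 0 \<le> B k) \<longrightarrow> summable (\<lambda>k. \<alpha> (Suc k) * B (Suc k)) \<longrightarrow>
        (\<Sum>k. \<alpha> (Suc k) * B (Suc k)) \<le> C \<longrightarrow>
          (\<forall>t\<ge>t0. condition_i \<epsilon> \<sigma> Rsup \<alpha> B t) \<and>
          (\<forall>t\<ge>t1. condition_ii \<epsilon> \<sigma> \<nu> p1 \<alpha> B t) \<and>
          (\<forall>t\<ge>t2. condition_iii \<epsilon> \<sigma> \<nu> G D \<kappa>\<^sub>1 \<alpha> B t)"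
      using thresholds[where C = C] by (elim exE conjE)
    have conds: "AE \<omega> in M. (\<forall>t\<ge>t0. condition_i \<epsilon> \<sigma> Rsup \<alpha> (\<lambda>k. B k \<omega>) t) \<and>
        (\<forall>t\<ge>t1. condition_ii \<epsilon> \<sigma> \<nu> p1 \<alpha> (\<lambda>k. B k \<omega>) t) \<and>
        (\<forall>t\<ge>t2. condition_iii \<epsilon> \<sigma> \<nu> G D \<kappa>\<^sub>1 \<alpha> (\<lambda>k. B k \<omega>) t)"
      using A3 C
    proof eventually_elim
      case (elim \<omega>)
      show ?case using all[THEN spec, of "\<lambda>k. B k \<omega>"] elim B0 by simp
    qed
    then have "(AE \<omega> in M. \<forall>t\<ge>t0. condition_i \<epsilon> \<sigma> Rsup \<alpha> (\<lambda>k. B k \<omega>) t) \<and>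
        (AE \<omega> in M. \<forall>t\<ge>t1. condition_ii \<epsilon> \<sigma> \<nu> p1 \<alpha> (\<lambda>k. B k \<omega>) t) \<and>
        (AE \<omega> in M. \<forall>t\<ge>t2. condition_iii \<epsilon> \<sigma> \<nu> G D \<kappa>\<^sub>1 \<alpha> (\<lambda>k. B k \<omega>) t)"
      by (simp only: AE_conj_iff)
    with t show "\<exists>t0\<ge>1. \<exists>t1\<ge>1. \<exists>t2\<ge>1.
        (AE \<omega> in M. \<forall>t\<ge>t0. condition_i \<epsilon> \<sigma> Rsup \<alpha> (\<lambda>k. B k \<omega>) t) \<and>
        (AE \<omega> in M. \<forall>t\<ge>t1. condition_ii \<epsilon> \<sigma> \<nu> p1 \<alpha> (\<lambda>k. B k \<omega>) t) \<and>
        (AE \<omega> in M. \<forall>t\<ge>t2. condition_iii \<epsilon> \<sigma> \<nu> G D \<kappa>\<^sub>1 \<alpha> (\<lambda>k. B k \<omega>) t)"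
      by (intro exI[of _ t0] exI[of _ t1] exI[of _ t2] conjI) simp_all
  qed
qed

end
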